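(* Let $L_K(E)$ be the Leavitt path algebra associated to a graph $E$ and let $n\ge1$. Then $P_c^{(n+1)}(E)$ is the hereditary and saturated closure (the smallest hereditary and saturated subset of $E^0$ containing it) of $$\mathfrak{S}_n=\{v\in E^0 \;\vert\; v\in c^0 \text{ for some cycle } c \text{ of } E \text{ such that } r(f)\in P_c^{(n)}(E)\text{ for every exit } f \text{ of } c\}.$$
   Context: Graphs are directed graphs $E=(E^0,E^1,r,s)$, assumed row-finite ($s^{-1}(v)$ finite for all $v$). $K$ is a field. $L_K(E)$ is the Leavitt path algebra: the $K$-algebra generated by $E^0\cup E^1\cup\{e^*: e\in E^1\}$ with relations $vw=\delta_{v,w}v$, $s(e)e=e=e\,r(e)$, $r(e)e^*=e^*=e^*s(e)$, $e^*f=\delta_{e,f}r(e)$, and $v=\sum_{s(e)=v}ee^*$ for each regular vertex $v$ ($0<|s^{-1}(v)|<\infty$). $I(X)$ is the two-sided ideal generated by a set $X$ of vertices. A set $X\subseteq E^0$ is hereditary if whenever $v\in X$ and there is a path from $v$ to $w$, then $w\in X$; it is saturated if every regular vertex $v$ with $r(s^{-1}(v))\subseteq X$ lies in $X$. For a cycle $c=e_1\cdots e_m$, $c^0$ is its set of vertices, and an exit of $c$ is an edge $e$ with $s(e)=s(e_i)$ and $e\neq e_i$ for some $i$. $P_c(E)$ is the set of vertices lying on cycles without exits. For $X$ hereditary and saturated, the quotient graph $E/X$ has vertex set $E^0\setminus X$ and edge set $\{e\in E^1: r(e)\notin X\}$; there is a canonical isomorphism $L_K(E)/I(X)\to L_K(E/X)$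 sending the class of each vertex $v\notin X$, each edge $e$ with $r(e)\notin X$ and its ghost $e^*$ to the element of the same name. $P_c^{(1)}(E)$ is the hereditary and saturated closure $\overline{P_c(E)}$ of $P_c(E)$ in $E$. Inductively, $P_c^{(n+1)}(E)$ is the hereditary and saturated subset of $E^0$ containing $P_c^{(n)}(E)$ such that the canonical isomorphism $L_K(E)/I(P_c^{(n)}(E))\cong L_K(E/P_c^{(n)}(E))$ maps $I(P_c^{(n+1)}(E))/I(P_c^{(n)}(E))$ onto $I\big(P_c(E/P_c^{(n)}(E))\big)$. *)

theory Defs
  imports "Graph_Theory.Graph_Theory" "HOL-Library.Poly_Mapping" "HOL-Library.FuncSet"
begin

section \<open>Algebras without unit\<close>

text \<open>
  Leavitt path algebras of graphs with infinitely many vertices have no unit, so the rings of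
  HOL-Algebra do not apply. The scalars come from the type \<open>'k\<close>.
\<close>

record ('k, 'a) nualg =
  elts :: "'a set"
  aadd :: "'a \<Rightarrow> 'a \<Rightarrow> 'a"
  azero :: "'a"
  amult :: "'a \<Rightarrow> 'a \<Rightarrow> 'a"
  ascale :: "'k \<Rightarrow> 'a \<Rightarrow> 'a"

definition alg_ideal :: "('k, 'a) nualg \<Rightarrow> 'a set \<Rightarrow> bool" where
  "alg_ideal A I \<longleftrightarrow>
     I \<subseteq> elts A \<and> azero A \<in> I \<and>
     (\<forall>x\<in>I. \<forall>y\<in>I. aadd A x y \<in> I) \<and>
     (\<forall>k. \<forall>x\<in>I. ascale A k x \<in> I) \<and>
     (\<forall>a\<in>elts A. \<forall>x\<in>I. amult A a x \<in> I \<and> amult A x a \<in> I)"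

definition ideal_gen :: "('k, 'a) nualg \<Rightarrow> 'a set \<Rightarrow> 'a set" where
  "ideal_gen A S = \<Inter>{I. alg_ideal A I \<and> S \<subseteq> I}"

definition coset :: "('k, 'a) nualg \<Rightarrow> 'a set \<Rightarrow> 'a \<Rightarrow> 'a set" where
  "coset A I x = aadd A x ` I"

text \<open>
  The product and the scalar multiple are saturated to full cosets: the plain set of products
  of two cosets need not be a coset.
\<close>

definition alg_quot :: "('k, 'a) nualg \<Rightarrow> 'a set \<Rightarrow> ('k, 'a set) nualg" where
  "alg_quot A I =
     \<lparr>elts = coset A I ` elts A,
      aadd = (\<lambda>P Q. {aadd A x y | x y. x \<in> P \<and> y \<in> Q}),
      azero = I,
      amult = (\<lambda>P Q. \<Union>x\<in>P. \<Union>y\<in>Q. coset A I (amult A x y)),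
      ascale = (\<lambda>k P. \<Union>x\<in>P. coset A I (ascale A k x))\<rparr>"

definition alg_hom :: "('k, 'a) nualg \<Rightarrow> ('k, 'b) nualg \<Rightarrow> ('a \<Rightarrow> 'b) \<Rightarrow> bool" where
  "alg_hom A B \<phi> \<longleftrightarrow>
     \<phi> ` elts A \<subseteq> elts B \<and>
     (\<forall>x\<in>elts A. \<forall>y\<in>elts A. \<phi> (aadd A x y) = aadd B (\<phi> x) (\<phi> y)) \<and>
     (\<forall>x\<in>elts A. \<forall>y\<in>elts A. \<phi> (amult A x y) = amult B (\<phi> x) (\<phi> y)) \<and>
     (\<forall>k. \<forall>x\<in>elts A. \<phi> (ascale A k x) = ascale B k (\<phi> x))"

definition alg_iso :: "('k, 'a) nualg \<Rightarrow> ('k, 'b) nualg \<Rightarrow> ('a \<Rightarrow> 'b) \<Rightarrow> bool" where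
  "alg_iso A B \<phi> \<longleftrightarrow> alg_hom A B \<phi> \<and> bij_betw \<phi> (elts A) (elts B)"


section \<open>Free algebras\<close>

text \<open>
  Lists form the free monoid under concatenation, so the convolution product of
  \<^type>\<open>poly_mapping\<close> over lists is the product of noncommutative polynomials.
\<close>

instantiation list :: (type) monoid_add
begin
definition zero_list :: "'a list" where "zero_list = []"
definition plus_list :: "'a list \<Rightarrow> 'a list \<Rightarrow> 'a list" where "plus_list = (@)"
instance by standard (simp_all add: zero_list_def plus_list_def)
end

text \<open>
  The free algebra without unit on \<open>G\<close>: noncommutative polynomials in the variables \<open>G\<close> with
  zero constant term.
\<close>

definition free_alg :: "'g set \<Rightarrow> ('k::field, 'g list \<Rightarrow>\<^sub>0 'k) nualg" where
  "free_alg G =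
     \<lparr>elts = {p. \<forall>w\<in>Poly_Mapping.keys p. w \<noteq> [] \<and> set w \<subseteq> G},
      aadd = (+),
      azero = 0,
      amult = (*),
      ascale = (\<lambda>k p. Poly_Mapping.single [] k * p)\<rparr>"

definition var :: "'g \<Rightarrow> ('g list \<Rightarrow>\<^sub>0 'k::field)" where
  "var g = Poly_Mapping.single [g] 1"


section \<open>Leavitt path algebras\<close>

text \<open>
  \<^const>\<open>tail\<close> is the source map \<open>s\<close>, \<^const>\<open>head\<close> is the range map \<open>r\<close>, and
  \<^term>\<open>out_arcs E v\<close> is the set of edges with source \<open>v\<close>.
\<close>

definition row_finite :: "('v, 'e) pre_digraph \<Rightarrow> bool" where
  "row_finite E \<longleftrightarrow> (\<forall>v\<in>verts E. finite (out_arcs E v))"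

definition regular_vertex :: "('v, 'e) pre_digraph \<Rightarrow> 'v \<Rightarrow> bool" where
  "regular_vertex E v \<longleftrightarrow> v \<in> verts E \<and> finite (out_arcs E v) \<and> out_arcs E v \<noteq> {}"

datatype ('v, 'e) lpa_gen = Vertex 'v | Edge 'e | Ghost 'e

definition lpa_gens :: "('v, 'e) pre_digraph \<Rightarrow> ('v, 'e) lpa_gen set" where
  "lpa_gens E = Vertex ` verts E \<union> Edge ` arcs E \<union> Ghost ` arcs E"

definition lpa_rels ::
  "('v, 'e) pre_digraph \<Rightarrow> (('v, 'e) lpa_gen list \<Rightarrow>\<^sub>0 'k::field) set" where
  "lpa_rels E =
     {var (Vertex v) * var (Vertex w) - (if v = w then var (Vertex v) else 0)
        | v w. v \<in> verts E \<and> w \<in> verts E} \<union>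
     {var (Vertex (tail E e)) * var (Edge e) - var (Edge e) | e. e \<in> arcs E} \<union>
     {var (Edge e) * var (Vertex (head E e)) - var (Edge e) | e. e \<in> arcs E} \<union>
     {var (Vertex (head E e)) * var (Ghost e) - var (Ghost e) | e. e \<in> arcs E} \<union>
     {var (Ghost e) * var (Vertex (tail E e)) - var (Ghost e) | e. e \<in> arcs E} \<union>
     {var (Ghost e) * var (Edge f) - (if e = f then var (Vertex (head E e)) else 0)
        | e f. e \<in> arcs E \<and> f \<in> arcs E} \<union>
     {var (Vertex v) - (\<Sum>e\<in>out_arcs E v. var (Edge e) * var (Ghost e))
        | v. regular_vertex E v}"

type_synonym ('v, 'e, 'k) lpa_elem = "(('v, 'e) lpa_gen list \<Rightarrow>\<^sub>0 'k) set"

definition lpa :: "('v, 'e) pre_digraph \<Rightarrow> ('k::field, ('v, 'e, 'k) lpa_elem) nualg" where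
  "lpa E = alg_quot (free_alg (lpa_gens E)) (ideal_gen (free_alg (lpa_gens E)) (lpa_rels E))"

definition lpa_of ::
  "('v, 'e) pre_digraph \<Rightarrow> ('v, 'e) lpa_gen \<Rightarrow> ('v, 'e, 'k::field) lpa_elem" where
  "lpa_of E g =
     coset (free_alg (lpa_gens E)) (ideal_gen (free_alg (lpa_gens E)) (lpa_rels E)) (var g)"

definition vertex_ideal ::
  "('v, 'e) pre_digraph \<Rightarrow> 'v set \<Rightarrow> ('v, 'e, 'k::field) lpa_elem set" where
  "vertex_ideal E X = ideal_gen (lpa E) ((\<lambda>v. lpa_of E (Vertex v)) ` X)"


section \<open>Hereditary and saturated sets, cycles\<close>

definition hereditary :: "('v, 'e) pre_digraph \<Rightarrow> 'v set \<Rightarrow> bool" where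
  "hereditary E X \<longleftrightarrow> (\<forall>v\<in>X. \<forall>w. v \<rightarrow>\<^sup>*\<^bsub>E\<^esub> w \<longrightarrow> w \<in> X)"

definition saturated :: "('v, 'e) pre_digraph \<Rightarrow> 'v set \<Rightarrow> bool" where
  "saturated E X \<longleftrightarrow> (\<forall>v. regular_vertex E v \<and> head E ` out_arcs E v \<subseteq> X \<longrightarrow> v \<in> X)"

definition her_sat :: "('v, 'e) pre_digraph \<Rightarrow> 'v set \<Rightarrow> bool" where
  "her_sat E X \<longleftrightarrow> X \<subseteq> verts E \<and> hereditary E X \<and> saturated E X"

definition her_sat_closure :: "('v, 'e) pre_digraph \<Rightarrow> 'v set \<Rightarrow> 'v set" where
  "her_sat_closure E X = \<Inter>{Y. her_sat E Y \<and> X \<subseteq> Y}"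

lemma her_sat_verts: "her_sat E (verts E)"
  by (auto simp: her_sat_def hereditary_def saturated_def regular_vertex_def
      elim: reachable_in_vertsE)

lemma her_sat_her_sat_closure:
  assumes "X \<subseteq> verts E"
  shows "her_sat E (her_sat_closure E X)"
  unfolding her_sat_def
proof (intro conjI)
  show "her_sat_closure E X \<subseteq> verts E"
    using assms her_sat_verts[of E] by (auto simp: her_sat_closure_def)
  show "hereditary E (her_sat_closure E X)"
    by (auto simp: her_sat_closure_def her_sat_def hereditary_def)
  show "saturated E (her_sat_closure E X)"
    unfolding her_sat_closure_def her_sat_def saturated_def by blast
qed

lemma subset_her_sat_closure: "X \<subseteq> her_sat_closure E X"
  by (auto simp: her_sat_closure_def)

lemma her_sat_closure_least: "her_sat E Y \<Longrightarrow> X \<subseteq> Y \<Longrightarrow> her_sat_closure E X \<subseteq> Y"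
  by (auto simp: her_sat_closure_def)

definition cycle_verts :: "('v, 'e) pre_digraph \<Rightarrow> 'e list \<Rightarrow> 'v set" where
  "cycle_verts E c = tail E ` set c"

definition is_exit :: "('v, 'e) pre_digraph \<Rightarrow> 'e list \<Rightarrow> 'e \<Rightarrow> bool" where
  "is_exit E c f \<longleftrightarrow> f \<in> arcs E \<and> (\<exists>e\<in>set c. tail E f = tail E e \<and> f \<noteq> e)"

definition Pc :: "('v, 'e) pre_digraph \<Rightarrow> 'v set" where
  "Pc E = {v. \<exists>c. pre_digraph.cycle E c \<and> v \<in> cycle_verts E c \<and> \<not> (\<exists>f. is_exit E c f)}"


section \<open>Quotient graphs and the sets \<open>P_c^(n)(E)\<close>\<close>

definition quot_graph :: "('v, 'e) pre_digraph \<Rightarrow> 'v set \<Rightarrow> ('v, 'e) pre_digraph" where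
  "quot_graph E X =
     \<lparr>verts = verts E - X, arcs = {e \<in> arcs E. head E e \<notin> X}, tail = tail E, head = head E\<rparr>"

definition lpa_quot ::
  "('v, 'e) pre_digraph \<Rightarrow> 'v set \<Rightarrow> ('k::field, ('v, 'e, 'k) lpa_elem set) nualg" where
  "lpa_quot E X = alg_quot (lpa E) (vertex_ideal E X)"

definition lpa_class ::
  "('v, 'e) pre_digraph \<Rightarrow> 'v set \<Rightarrow> ('v, 'e, 'k::field) lpa_elem \<Rightarrow> ('v, 'e, 'k) lpa_elem set"
  where "lpa_class E X = coset (lpa E) (vertex_ideal E X)"

text \<open>\<^const>\<open>extensional\<close> makes the function unique outside the quotient algebra as well.\<close>

definition canonical_iso ::
  "('v, 'e) pre_digraph \<Rightarrow> 'v set \<Rightarrow> ('v, 'e, 'k::field) lpa_elem set \<Rightarrow> ('v, 'e, 'k) lpa_elem"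
  where
  "canonical_iso E X =
     (THE \<phi>. \<phi> \<in> extensional (elts (lpa_quot E X)) \<and>
        alg_iso (lpa_quot E X) (lpa (quot_graph E X)) \<phi> \<and>
        (\<forall>v\<in>verts E - X.
           \<phi> (lpa_class E X (lpa_of E (Vertex v))) = lpa_of (quot_graph E X) (Vertex v)) \<and>
        (\<forall>e\<in>arcs E. head E e \<notin> X \<longrightarrow>
           \<phi> (lpa_class E X (lpa_of E (Edge e))) = lpa_of (quot_graph E X) (Edge e) \<and>
           \<phi> (lpa_class E X (lpa_of E (Ghost e))) = lpa_of (quot_graph E X) (Ghost e)))"

text \<open>
  For \<open>P = P_c^(n)(E)\<close> the following is \<open>P_c^(n+1)(E)\<close>; the image of \<^term>\<open>vertex_ideal E X\<close>
  under \<^term>\<open>lpa_class E P\<close> is the ideal \<open>I(X)/I(P)\<close> of the quotient algebra. The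
  definition goes through the algebra over \<open>'k\<close>, hence the type argument.
\<close>

definition Pc_next :: "'k::field itself \<Rightarrow> ('v, 'e) pre_digraph \<Rightarrow> 'v set \<Rightarrow> 'v set" where
  "Pc_next (K :: 'k itself) E P =
     (THE X. her_sat E X \<and> P \<subseteq> X \<and>
        canonical_iso E P ` lpa_class E P ` vertex_ideal E X =
          (vertex_ideal (quot_graph E P) (Pc (quot_graph E P)) :: ('v, 'e, 'k) lpa_elem set))"

text \<open>The sequence starts at index 1; the value at 0 is a dummy.\<close>

fun Pc_seq :: "'k::field itself \<Rightarrow> ('v, 'e) pre_digraph \<Rightarrow> nat \<Rightarrow> 'v set" where
  "Pc_seq K E 0 = {}"
| "Pc_seq K E (Suc 0) = her_sat_closure E (Pc E)"
| "Pc_seq K E (Suc (Suc n)) = Pc_next K E (Pc_seq K E (Suc n))"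

end

(*
  The canonical isomorphism L(E)/I(P) -> L(E/P) carries the image of I(X) to I(X - P), so
  P_c^(n+1) is the hereditary and saturated set X containing P = P_c^(n) for which X - P and
  P_c(E/P) generate the same ideal of L(E/P). Such an X is unique, because a hereditary and
  saturated set H contains every vertex of I(H): the Leavitt path algebra acts on the functions on
  V x N such that exactly the vertices in H act as zero. The vertices in a given ideal form a
  hereditary and saturated set, so the closure of S_n is such an X if it contains P. The latter
  holds by induction, because S_(n-1) is contained in S_n.
*)
theory Submission
  imports Defs
begin

section \<open>Algebras, ideals and quotients\<close>

text \<open>\<open>canonical_iso\<close> and \<open>Pc_next\<close> are definite descriptions, so
  nothing can be said about either before existence and uniqueness are proved; most of the
  development serves this. The computations take place with noncommutative polynomials: an ideal of
  L(E) is pulled back to an ideal of the free algebra that contains the relations, and two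
  homomorphisms are compared on the variables alone. The factor N in V x N makes room. The relation
  v = sum of e e* forces the space at v to be the direct sum of the spaces at the heads of the edges
  leaving v, which nonzero finite dimensions cannot satisfy at a vertex whose outgoing edges are two
  loops. A countable fibre splits into any positive finite number of copies of itself, so the same
  fibre serves at every vertex. Row-finiteness keeps this number finite, and saturation keeps it
  positive at the regular vertices outside H.\<close>

locale na_algebra =
  fixes A :: "('k::field, 'a) nualg"
  assumes zero_closed [simp]: "azero A \<in> elts A"
    and add_closed [simp]: "x \<in> elts A \<Longrightarrow> y \<in> elts A \<Longrightarrow> aadd A x y \<in> elts A"
    and mult_closed [simp]: "x \<in> elts A \<Longrightarrow> y \<in> elts A \<Longrightarrow> amult A x y \<in> elts A"
    and scale_closed [simp]: "x \<in> elts A \<Longrightarrow> ascale A k x \<in> elts A"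
    and add_assoc: "x \<in> elts A \<Longrightarrow> y \<in> elts A \<Longrightarrow> z \<in> elts A \<Longrightarrow>
      aadd A (aadd A x y) z = aadd A x (aadd A y z)"
    and add_commute: "x \<in> elts A \<Longrightarrow> y \<in> elts A \<Longrightarrow> aadd A x y = aadd A y x"
    and add_zero [simp]: "x \<in> elts A \<Longrightarrow> aadd A x (azero A) = x"
    and add_neg [simp]: "x \<in> elts A \<Longrightarrow> aadd A x (ascale A (- 1) x) = azero A"
    and mult_add_left: "x \<in> elts A \<Longrightarrow> y \<in> elts A \<Longrightarrow> z \<in> elts A \<Longrightarrow>
      amult A (aadd A x y) z = aadd A (amult A x z) (amult A y z)"
    and mult_add_right: "x \<in> elts A \<Longrightarrow> y \<in> elts A \<Longrightarrow> z \<in> elts A \<Longrightarrow>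
      amult A x (aadd A y z) = aadd A (amult A x y) (amult A x z)"
    and scale_add: "x \<in> elts A \<Longrightarrow> y \<in> elts A \<Longrightarrow>
      ascale A k (aadd A x y) = aadd A (ascale A k x) (ascale A k y)"
begin

lemma add_left_commute:
  "x \<in> elts A \<Longrightarrow> y \<in> elts A \<Longrightarrow> z \<in> elts A \<Longrightarrow>
     aadd A x (aadd A y z) = aadd A y (aadd A x z)"
  by (metis add_assoc add_commute)

lemmas add_ac = add_assoc add_commute add_left_commute

lemma zero_add [simp]: "x \<in> elts A \<Longrightarrow> aadd A (azero A) x = x"
  by (simp add: add_commute)

lemma add_neg_cancel:
  assumes "x \<in> elts A" "y \<in> elts A"
  shows "aadd A (aadd A x y) (ascale A (- 1) y) = x"
  using assms by (simp add: add_assoc)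

text \<open>Cancellation recognizes zero. That \<open>azero A\<close> is absorbing, is fixed by
  scalars and is preserved by homomorphisms thus reduces to additivity.\<close>

lemma eq_zero_if_idem:
  assumes "x \<in> elts A" "aadd A x x = x"
  shows "x = azero A"
  using add_neg_cancel[of x x] assms by simp

lemma mult_zero [simp]:
  assumes "x \<in> elts A"
  shows "amult A x (azero A) = azero A" "amult A (azero A) x = azero A"
  by (rule eq_zero_if_idem;
      use assms mult_add_left[of "azero A" "azero A" x] mult_add_right[of x "azero A" "azero A"]
      in simp)+

lemma scale_zero [simp]: "ascale A k (azero A) = azero A"
  by (rule eq_zero_if_idem) (use scale_add[of "azero A" "azero A" k] in simp_all)

lemma alg_ideal_zero: "alg_ideal A {azero A}"
  by (simp add: alg_ideal_def)

text \<open>For \<open>S\<close> outside the carrier the family in \<open>ideal_gen\<close> is empty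
  and its intersection is \<open>UNIV\<close>; here the carrier itself belongs to the family and
  bounds the intersection.\<close>

lemma alg_ideal_ideal_gen:
  assumes "S \<subseteq> elts A"
  shows "alg_ideal A (ideal_gen A S)"
proof -
  have "alg_ideal A (elts A)"
    by (simp add: alg_ideal_def)
  then have "ideal_gen A S \<subseteq> elts A"
    using assms by (auto simp: ideal_gen_def)
  then show ?thesis
    unfolding alg_ideal_def by (auto simp: ideal_gen_def alg_ideal_def)
qed

end

lemma subset_ideal_gen: "S \<subseteq> ideal_gen A S"
  by (auto simp: ideal_gen_def)

lemma ideal_gen_least: "alg_ideal A I \<Longrightarrow> S \<subseteq> I \<Longrightarrow> ideal_gen A S \<subseteq> I"
  by (auto simp: ideal_gen_def)

lemma ideal_gen_mono: "S \<subseteq> T \<Longrightarrow> ideal_gen A S \<subseteq> ideal_gen A T"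
  unfolding ideal_gen_def by blast

lemma ideal_gen_insert_zero: "ideal_gen A (insert (azero A) S) = ideal_gen A S"
  by (auto simp: ideal_gen_def alg_ideal_def)

text \<open>Evaluates the unions in the product and the scalar multiple of cosets: all
  representatives contribute the same coset, and there is at least one.\<close>

lemma UN_eq_const: "a \<in> B \<Longrightarrow> (\<And>y. y \<in> B \<Longrightarrow> F y = c) \<Longrightarrow> (\<Union>y\<in>B. F y) = c"
  by auto

locale na_ideal = na_algebra A for A :: "('k::field, 'a) nualg" +
  fixes I :: "'a set"
  assumes ideal: "alg_ideal A I"
begin

lemma ideal_elts [simp]: "x \<in> I \<Longrightarrow> x \<in> elts A"
  using ideal by (auto simp: alg_ideal_def)

lemma ideal_zero [simp]: "azero A \<in> I"
  using ideal by (auto simp: alg_ideal_def)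

lemma ideal_add [simp]: "x \<in> I \<Longrightarrow> y \<in> I \<Longrightarrow> aadd A x y \<in> I"
  using ideal by (auto simp: alg_ideal_def)

lemma ideal_scale [simp]: "x \<in> I \<Longrightarrow> ascale A k x \<in> I"
  using ideal by (auto simp: alg_ideal_def)

lemma ideal_mult [simp]:
  assumes "a \<in> elts A" "x \<in> I"
  shows "amult A a x \<in> I" "amult A x a \<in> I"
  using assms ideal by (auto simp: alg_ideal_def)

lemma coset_add_ideal:
  assumes "x \<in> elts A" "i \<in> I"
  shows "coset A I (aadd A x i) = coset A I x"
proof
  show "coset A I (aadd A x i) \<subseteq> coset A I x"
    using assms by (auto simp: coset_def add_assoc)
  show "coset A I x \<subseteq> coset A I (aadd A x i)"
  proof
    fix z assume "z \<in> coset A I x"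
    then obtain j where j: "j \<in> I" "z = aadd A x j"
      by (auto simp: coset_def)
    have "z = aadd A (aadd A x i) (aadd A (ascale A (- 1) i) j)"
      using j assms
      by (metis add_assoc add_closed add_neg_cancel ideal_elts ideal_scale)
    then show "z \<in> coset A I (aadd A x i)"
      using j assms by (auto simp: coset_def)
  qed
qed

lemma mem_coset_self: "x \<in> elts A \<Longrightarrow> x \<in> coset A I x"
  by (auto simp: coset_def image_iff intro!: bexI[of _ "azero A"])

lemma coset_zero: "coset A I (azero A) = I"
  by (auto simp: coset_def image_iff)

lemma coset_ideal: "i \<in> I \<Longrightarrow> coset A I i = I"
  using coset_add_ideal[of "azero A" i] coset_zero by simp

lemma quot_zero: "azero (alg_quot A I) = coset A I (azero A)"
  by (simp add: alg_quot_def coset_zero)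

lemma quot_elts: "elts (alg_quot A I) = coset A I ` elts A"
  by (simp add: alg_quot_def)

lemma quot_add:
  assumes "x \<in> elts A" "y \<in> elts A"
  shows "aadd (alg_quot A I) (coset A I x) (coset A I y) = coset A I (aadd A x y)"
proof -
  have "\<exists>k\<in>I. aadd A (aadd A x i) (aadd A y j) = aadd A (aadd A x y) k"
    if "i \<in> I" "j \<in> I" for i j
    using assms that by (intro bexI[of _ "aadd A i j"]) (auto simp: add_ac)
  \<comment> \<open>The sum of cosets is a plain sum of sets, so each element has to be split; the
    whole ideal part goes to the second summand.\<close>
  moreover have "\<exists>i\<in>I. \<exists>j\<in>I. aadd A (aadd A x y) k = aadd A (aadd A x i) (aadd A y j)"
    if "k \<in> I" for k
    using assms that
    by (intro bexI[of _ "azero A"] bexI[of _ k]) (auto simp: add_ac)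
  ultimately show ?thesis
    by (fastforce simp: alg_quot_def coset_def image_iff)
qed

lemma quot_mult:
  assumes "x \<in> elts A" "y \<in> elts A"
  shows "amult (alg_quot A I) (coset A I x) (coset A I y) = coset A I (amult A x y)"
proof -
  have *: "coset A I (amult A x' y') = coset A I (amult A x y)"
    if "x' \<in> coset A I x" "y' \<in> coset A I y" for x' y'
  proof -
    obtain i j where ij: "i \<in> I" "x' = aadd A x i" "j \<in> I" "y' = aadd A y j"
      using \<open>x' \<in> _\<close> \<open>y' \<in> _\<close> by (auto simp: coset_def)
    \<comment> \<open>Each term other than \<open>amult A x y\<close> has a factor in
      \<open>I\<close>.\<close>
    have "amult A x' y' =
        aadd A (amult A x y) (aadd A (amult A i y) (aadd A (amult A x j) (amult A i j)))"
      using assms ij by (simp add: mult_add_left mult_add_right add_assoc)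
    then show ?thesis
      using assms ij by (simp add: coset_add_ideal)
  qed
  have "(\<Union>y'\<in>coset A I y. coset A I (amult A x' y')) = coset A I (amult A x y)"
    if "x' \<in> coset A I x" for x'
    by (rule UN_eq_const[OF mem_coset_self[OF assms(2)]]) (rule *[OF that])
  from UN_eq_const[OF mem_coset_self[OF assms(1)] this] show ?thesis
    by (simp add: alg_quot_def)
qed

lemma quot_scale:
  assumes "x \<in> elts A"
  shows "ascale (alg_quot A I) k (coset A I x) = coset A I (ascale A k x)"
proof -
  have "coset A I (ascale A k x') = coset A I (ascale A k x)" if "x' \<in> coset A I x" for x'
  proof -
    obtain i where "i \<in> I" "x' = aadd A x i"
      using \<open>x' \<in> _\<close> by (auto simp: coset_def)
    then show ?thesis
      using assms by (simp add: scale_add coset_add_ideal)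
  qed
  from UN_eq_const[OF mem_coset_self[OF assms] this] show ?thesis
    by (simp add: alg_quot_def)
qed

lemma alg_hom_coset: "alg_hom A (alg_quot A I) (coset A I)"
  by (simp add: alg_hom_def quot_elts quot_add quot_mult quot_scale)

lemma na_algebra_quot: "na_algebra (alg_quot A I)"
proof
  fix x y z and k :: 'k
  show "azero (alg_quot A I) \<in> elts (alg_quot A I)"
    by (simp add: quot_zero quot_elts)
  assume "x \<in> elts (alg_quot A I)"
  then obtain a where a: "a \<in> elts A" "x = coset A I a"
    by (auto simp: quot_elts)
  show "ascale (alg_quot A I) k x \<in> elts (alg_quot A I)"
    "aadd (alg_quot A I) x (azero (alg_quot A I)) = x"
    "aadd (alg_quot A I) x (ascale (alg_quot A I) (- 1) x) = azero (alg_quot A I)"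
    using a by (simp_all add: quot_scale quot_zero quot_add quot_elts)
  assume "y \<in> elts (alg_quot A I)"
  then obtain b where b: "b \<in> elts A" "y = coset A I b"
    by (auto simp: quot_elts)
  show "aadd (alg_quot A I) x y \<in> elts (alg_quot A I)"
    "amult (alg_quot A I) x y \<in> elts (alg_quot A I)"
    "aadd (alg_quot A I) x y = aadd (alg_quot A I) y x"
    "ascale (alg_quot A I) k (aadd (alg_quot A I) x y) =
       aadd (alg_quot A I) (ascale (alg_quot A I) k x) (ascale (alg_quot A I) k y)"
    using a b by (simp_all add: quot_scale quot_mult quot_add quot_elts add_commute scale_add)
  assume "z \<in> elts (alg_quot A I)"
  then obtain c where c: "c \<in> elts A" "z = coset A I c"
    by (auto simp: quot_elts)
  show "aadd (alg_quot A I) (aadd (alg_quot A I) x y) z =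
       aadd (alg_quot A I) x (aadd (alg_quot A I) y z)"
    "amult (alg_quot A I) (aadd (alg_quot A I) x y) z =
       aadd (alg_quot A I) (amult (alg_quot A I) x z) (amult (alg_quot A I) y z)"
    "amult (alg_quot A I) x (aadd (alg_quot A I) y z) =
       aadd (alg_quot A I) (amult (alg_quot A I) x y) (amult (alg_quot A I) x z)"
    using a b c
    by (simp_all add: quot_mult quot_add add_assoc mult_add_left mult_add_right)
qed

lemma quot_eq_zero_iff:
  assumes "x \<in> elts A"
  shows "coset A I x = azero (alg_quot A I) \<longleftrightarrow> x \<in> I"
  using mem_coset_self[OF assms] coset_ideal by (auto simp: quot_zero coset_zero)

end

section \<open>Homomorphisms and factorization through quotients\<close>

lemma alg_hom_comp: "alg_hom A B f \<Longrightarrow> alg_hom B C g \<Longrightarrow> alg_hom A C (g \<circ> f)"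
  by (auto simp: alg_hom_def image_subset_iff)

text \<open>\<open>alg_hom\<close> evaluates its map only at carrier elements, since the carrier is
  closed under the operations. This allows a homomorphism to be cut down to an extensional
  function.\<close>

lemma alg_hom_cong:
  assumes "na_algebra A" "\<And>x. x \<in> elts A \<Longrightarrow> f x = g x"
  shows "alg_hom A B f \<longleftrightarrow> alg_hom A B g"
proof -
  interpret na_algebra A by fact
  show ?thesis
    using assms(2) by (simp add: alg_hom_def image_subset_iff)
qed

locale na_hom = A: na_algebra A + B: na_algebra B
  for A :: "('k::field, 'a) nualg" and B :: "('k, 'b) nualg" +
  fixes f :: "'a \<Rightarrow> 'b"
  assumes hom: "alg_hom A B f"
begin

lemma hom_closed [simp]: "x \<in> elts A \<Longrightarrow> f x \<in> elts B"
  using hom by (auto simp: alg_hom_def)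

lemma hom_add: "x \<in> elts A \<Longrightarrow> y \<in> elts A \<Longrightarrow> f (aadd A x y) = aadd B (f x) (f y)"
  using hom by (auto simp: alg_hom_def)

lemma hom_mult: "x \<in> elts A \<Longrightarrow> y \<in> elts A \<Longrightarrow> f (amult A x y) = amult B (f x) (f y)"
  using hom by (auto simp: alg_hom_def)

lemma hom_scale: "x \<in> elts A \<Longrightarrow> f (ascale A k x) = ascale B k (f x)"
  using hom by (auto simp: alg_hom_def)

lemma hom_zero: "f (azero A) = azero B"
  by (rule B.eq_zero_if_idem) (simp_all flip: hom_add)

lemma alg_ideal_preimage:
  assumes "alg_ideal B J"
  shows "alg_ideal A {x \<in> elts A. f x \<in> J}"
  using assms by (simp add: alg_ideal_def hom_zero hom_add hom_mult hom_scale)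

lemma alg_ideal_kernel: "alg_ideal A {x \<in> elts A. f x = azero B}"
  using alg_ideal_preimage[OF B.alg_ideal_zero] by simp

lemma hom_ideal_gen_eq_zero:
  assumes "S \<subseteq> elts A" "\<And>x. x \<in> S \<Longrightarrow> f x = azero B" "x \<in> ideal_gen A S"
  shows "f x = azero B"
  using ideal_gen_least[OF alg_ideal_kernel, of S] assms by blast

lemma alg_ideal_image:
  assumes "f ` elts A = elts B" "alg_ideal A I"
  shows "alg_ideal B (f ` I)"
proof -
  interpret I: na_ideal A I
    by (unfold_locales) fact
  have "amult B b (f x) \<in> f ` I \<and> amult B (f x) b \<in> f ` I" if "x \<in> I" "b \<in> elts B" for x b
  proof -
    obtain a where "a \<in> elts A" "b = f a"
      using \<open>b \<in> elts B\<close> assms(1) by blast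
    then show ?thesis
      using that by (simp flip: hom_mult)
  qed
  moreover have "azero B \<in> f ` I"
    using hom_zero[symmetric] by simp
  ultimately show ?thesis
    by (auto simp: alg_ideal_def simp flip: hom_add hom_scale)
qed

text \<open>Both inclusions are minimality of a generated ideal: preimages of ideals are ideals, and
  under a surjection so are images. Vertex ideals are transported along projections in this
  way.\<close>

lemma image_ideal_gen:
  assumes "f ` elts A = elts B" "S \<subseteq> elts A"
  shows "f ` ideal_gen A S = ideal_gen B (f ` S)"
proof
  have "f ` S \<subseteq> elts B"
    using assms by auto
  then have "alg_ideal B (ideal_gen B (f ` S))"
    by (rule B.alg_ideal_ideal_gen)
  from ideal_gen_least[OF alg_ideal_preimage[OF this], of S]
  show "f ` ideal_gen A S \<subseteq> ideal_gen B (f ` S)"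
    using assms(2) subset_ideal_gen[of "f ` S" B] by blast
  show "ideal_gen B (f ` S) \<subseteq> f ` ideal_gen A S"
    by (intro ideal_gen_least alg_ideal_image A.alg_ideal_ideal_gen assms image_mono
        subset_ideal_gen)
qed

text \<open>The factor map takes the value of \<open>f\<close> at a chosen representative of the
  coset; two representatives differ by an element of \<open>I\<close>, where \<open>f\<close>
  vanishes.\<close>

lemma alg_quot_factor:
  assumes "alg_ideal A I" "\<And>x. x \<in> I \<Longrightarrow> f x = azero B"
  obtains h where "alg_hom (alg_quot A I) B h" "\<And>x. x \<in> elts A \<Longrightarrow> h (coset A I x) = f x"
proof
  interpret I: na_ideal A I
    by unfold_locales fact
  define h where "h P = f (SOME x. x \<in> elts A \<and> coset A I x = P)" for P
  show h: "h (coset A I x) = f x" if x: "x \<in> elts A" for x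
  proof -
    define y where "y = (SOME y. y \<in> elts A \<and> coset A I y = coset A I x)"
    have y: "y \<in> elts A" "coset A I y = coset A I x"
      using someI[of "\<lambda>y. y \<in> elts A \<and> coset A I y = coset A I x" x] x by (auto simp: y_def)
    then obtain i where i: "i \<in> I" "y = aadd A x i"
      using I.mem_coset_self[of y] by (auto simp: coset_def)
    have "h (coset A I x) = f y"
      by (simp add: h_def y_def)
    also have "\<dots> = f x"
      using i x assms(2) by (simp add: hom_add)
    finally show ?thesis .
  qed
  show "alg_hom (alg_quot A I) B h"
    by (auto simp: alg_hom_def I.quot_elts I.quot_add I.quot_mult I.quot_scale h
        hom_add hom_mult hom_scale)
qed

end

section \<open>Free algebras\<close>

lemma update_eq_add:
  assumes "w \<notin> Poly_Mapping.keys p"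
  shows "Poly_Mapping.update w c p = p + Poly_Mapping.single w c"
  using assms
  by (intro poly_mapping_eqI)
    (auto simp: lookup_update lookup_add lookup_single when_def in_keys_iff)

lemma poly_mapping_induct_add [case_names single add]:
  fixes p :: "'a \<Rightarrow>\<^sub>0 'b::comm_monoid_add"
  assumes "\<And>w c. P (Poly_Mapping.single w c)"
    and "\<And>p q. P p \<Longrightarrow> P q \<Longrightarrow> P (p + q)"
  shows "P p"
proof (induction p rule: update_induct)
  case const
  then show ?case
    using assms(1)[of undefined 0] by simp
next
  case (update p w c)
  then show ?case
    using assms by (simp add: update_eq_add)
qed

lemma elts_free_alg: "elts (free_alg G) = {p. \<forall>w\<in>Poly_Mapping.keys p. w \<noteq> [] \<and> set w \<subseteq> G}"
  and aadd_free_alg [simp]: "aadd (free_alg G) = (+)"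
  and azero_free_alg [simp]: "azero (free_alg G) = 0"
  and amult_free_alg [simp]: "amult (free_alg G) = (*)"
  and ascale_free_alg: "ascale (free_alg G) k p = Poly_Mapping.single [] k * p"
  by (simp_all add: free_alg_def)

lemma single_Nil_minus_one: "Poly_Mapping.single [] (- 1) * p = - (p :: 'g list \<Rightarrow>\<^sub>0 'k::field)"
  by (metis mult_minus1 single_one single_uminus zero_list_def)

lemma na_algebra_free_alg: "na_algebra (free_alg G :: ('k::field, 'g list \<Rightarrow>\<^sub>0 'k) nualg)"
proof
  fix x y z :: "'g list \<Rightarrow>\<^sub>0 'k" and k :: 'k
  show "x \<in> elts (free_alg G) \<Longrightarrow> y \<in> elts (free_alg G) \<Longrightarrow>
      aadd (free_alg G) x y \<in> elts (free_alg G)"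
    using keys_add[of x y] by (fastforce simp: elts_free_alg)
  show "amult (free_alg G) x y \<in> elts (free_alg G)"
    if "x \<in> elts (free_alg G)" "y \<in> elts (free_alg G)"
  proof -
    have "w \<noteq> [] \<and> set w \<subseteq> G" if "w \<in> Poly_Mapping.keys (x * y)" for w
    proof -
      obtain u v where "w = u @ v" "u \<in> Poly_Mapping.keys x" "v \<in> Poly_Mapping.keys y"
        using keys_mult[of x y] \<open>w \<in> _\<close> by (auto simp: plus_list_def)
      then show ?thesis
        using \<open>x \<in> _\<close> \<open>y \<in> _\<close> by (simp add: elts_free_alg)
    qed
    then show ?thesis
      by (simp add: elts_free_alg)
  qed
  show "ascale (free_alg G) k x \<in> elts (free_alg G)" if "x \<in> elts (free_alg G)"
  proof -
    \<comment> \<open>Written as a coefficientwise map, scaling visibly adds no words.\<close>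
    have "ascale (free_alg G) k x = Poly_Mapping.map ((*) k) x"
      by (simp add: ascale_free_alg mult_map_scale_conv_mult zero_list_def)
    then show ?thesis
      using that by (auto simp: elts_free_alg in_keys_iff map.rep_eq when_def)
  qed
qed (simp_all add: elts_free_alg ascale_free_alg algebra_simps single_Nil_minus_one)

lemma var_in_free_alg [simp]: "var g \<in> elts (free_alg G) \<longleftrightarrow> g \<in> G"
  by (auto simp: elts_free_alg var_def)

lemma free_alg_mono: "G' \<subseteq> G \<Longrightarrow> elts (free_alg G') \<subseteq> elts (free_alg G)"
  by (auto simp: elts_free_alg)

lemma alg_hom_free_alg_mono:
  assumes "G' \<subseteq> G" "alg_hom (free_alg G) B f"
  shows "alg_hom (free_alg G') B f"
  using assms(2)
  by (simp add: alg_hom_def ascale_free_alg image_subset_iff subsetD[OF free_alg_mono[OF assms(1)]])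

lemma free_alg_mult_closed [simp]:
  "p \<in> elts (free_alg G) \<Longrightarrow> q \<in> elts (free_alg G) \<Longrightarrow> p * q \<in> elts (free_alg G)"
  using na_algebra.mult_closed[OF na_algebra_free_alg] by fastforce

lemma free_alg_add_closed [simp]:
  "p \<in> elts (free_alg G) \<Longrightarrow> q \<in> elts (free_alg G) \<Longrightarrow> p + q \<in> elts (free_alg G)"
  using na_algebra.add_closed[OF na_algebra_free_alg] by fastforce

lemma free_alg_diff_closed [simp]:
  "p \<in> elts (free_alg G) \<Longrightarrow> q \<in> elts (free_alg G) \<Longrightarrow> p - q \<in> elts (free_alg G)"
  using keys_diff[of p q] by (fastforce simp: elts_free_alg)

lemma free_alg_zero_closed [simp]: "0 \<in> elts (free_alg G)"
  by (simp add: elts_free_alg)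

lemma free_alg_sum_closed [simp]:
  "(\<And>i. i \<in> S \<Longrightarrow> p i \<in> elts (free_alg G)) \<Longrightarrow> sum p S \<in> elts (free_alg G)"
  by (induction S rule: infinite_finite_induct) simp_all

text \<open>Words are products of letters, monomials are scaled words, polynomials are sums of
  monomials. As constant terms are excluded, the induction on words starts at a single
  letter.\<close>

lemma free_alg_induct [consumes 1, case_names var add mult scale]:
  fixes p :: "'g list \<Rightarrow>\<^sub>0 'k::field"
  assumes "p \<in> elts (free_alg G)"
    and var: "\<And>g. g \<in> G \<Longrightarrow> P (var g)"
    and add: "\<And>p q. p \<in> elts (free_alg G) \<Longrightarrow> q \<in> elts (free_alg G) \<Longrightarrow> P p \<Longrightarrow> P q \<Longrightarrow> P (p + q)"
    and mult: "\<And>p q. p \<in> elts (free_alg G) \<Longrightarrow> q \<in> elts (free_alg G) \<Longrightarrow> P p \<Longrightarrow> P q \<Longrightarrow> P (p * q)"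
    and scale: "\<And>k p. p \<in> elts (free_alg G) \<Longrightarrow> P p \<Longrightarrow> P (ascale (free_alg G) k p)"
    and zero: "P 0"
  shows "P p"
proof -
  have word: "P (Poly_Mapping.single w 1)" if "w \<noteq> []" "set w \<subseteq> G" for w
    using that
  proof (induction w rule: list_nonempty_induct)
    case (single g)
    then show ?case
      using var by (simp add: var_def)
  next
    case (cons g w)
    have "Poly_Mapping.single (g # w) 1 = var g * Poly_Mapping.single w (1 :: 'k)"
      by (simp add: var_def mult_single plus_list_def)
    moreover have "Poly_Mapping.single w (1 :: 'k) \<in> elts (free_alg G)"
      using cons by (simp add: elts_free_alg)
    ultimately show ?case
      using cons mult[of "var g" "Poly_Mapping.single w 1"] var by simp
  qed
  have monom: "P (Poly_Mapping.single w c)" if "w \<noteq> []" "set w \<subseteq> G" for w c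
  proof -
    have "Poly_Mapping.single w c = ascale (free_alg G) c (Poly_Mapping.single w 1)"
      by (simp add: ascale_free_alg mult_single plus_list_def)
    then show ?thesis
      using scale[OF _ word[OF that]] that by (simp add: elts_free_alg)
  qed
  show ?thesis
    using assms(1)
  proof (induction p rule: update_induct)
    case const
    then show ?case
      using zero by simp
  next
    case (update p w c)
    have "w \<noteq> []" "set w \<subseteq> G" "p \<in> elts (free_alg G)"
      using update by (auto simp: elts_free_alg keys_update)
    then show ?case
      using add[OF _ _ update.IH monom] unfolding update_eq_add[OF update(1)]
      by (simp add: elts_free_alg)
  qed
qed

lemma free_alg_hom_eqI:
  assumes "na_algebra B" "alg_hom (free_alg G) B f" "alg_hom (free_alg G) B f'"
    and "\<And>g. g \<in> G \<Longrightarrow> f (var g) = f' (var g)" and "p \<in> elts (free_alg G)"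
  shows "f p = f' p"
proof -
  interpret f: na_hom "free_alg G" B f
    by (intro na_hom.intro na_hom_axioms.intro na_algebra_free_alg assms)
  interpret f': na_hom "free_alg G" B f'
    by (intro na_hom.intro na_hom_axioms.intro na_algebra_free_alg assms)
  show ?thesis
    using assms(5)
  proof (induction p rule: free_alg_induct)
    case (add p q)
    then show ?case
      using f.hom_add[of p q] f'.hom_add[of p q] by simp
  next
    case (mult p q)
    then show ?case
      using f.hom_mult[of p q] f'.hom_mult[of p q] by simp
  qed (use assms(4) f.hom_scale f'.hom_scale f.hom_zero f'.hom_zero in simp_all)
qed

text \<open>The homomorphism that sends the generators outside \<open>G\<close> to \<open>0\<close>.\<close>

definition restrict_gens :: "'g set \<Rightarrow> ('g list \<Rightarrow>\<^sub>0 'k) \<Rightarrow> ('g list \<Rightarrow>\<^sub>0 'k::field)" where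
  "restrict_gens G = Poly_Mapping.mapp (\<lambda>w c. if set w \<subseteq> G then c else 0)"

lemma lookup_restrict_gens:
  "Poly_Mapping.lookup (restrict_gens G p) w = (if set w \<subseteq> G then Poly_Mapping.lookup p w else 0)"
  by (simp add: restrict_gens_def lookup_mapp when_def in_keys_iff)

lemma restrict_gens_add: "restrict_gens G (p + q) = restrict_gens G p + restrict_gens G q"
  by (intro poly_mapping_eqI) (simp add: lookup_restrict_gens lookup_add)

lemma restrict_gens_zero [simp]: "restrict_gens G 0 = 0"
  by (intro poly_mapping_eqI) (simp add: lookup_restrict_gens)

lemma restrict_gens_diff: "restrict_gens G (p - q) = restrict_gens G p - restrict_gens G q"
  by (intro poly_mapping_eqI) (simp add: lookup_restrict_gens lookup_minus)

lemma restrict_gens_sum: "restrict_gens G (sum p S) = (\<Sum>i\<in>S. restrict_gens G (p i))"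
  by (intro poly_mapping_eqI) (simp add: lookup_restrict_gens lookup_sum)

lemma restrict_gens_single:
  "restrict_gens G (Poly_Mapping.single w c) =
     (if set w \<subseteq> G then Poly_Mapping.single w c else 0)"
  by (intro poly_mapping_eqI) (auto simp: lookup_restrict_gens lookup_single when_def)

text \<open>A concatenation consists of letters from \<open>G\<close> exactly when both parts
  do.\<close>

lemma restrict_gens_mult: "restrict_gens G (p * q) = restrict_gens G p * restrict_gens G q"
proof (induction p rule: poly_mapping_induct_add)
  case (single u a)
  show ?case
    by (induction q rule: poly_mapping_induct_add)
      (auto simp: restrict_gens_single mult_single plus_list_def distrib_left restrict_gens_add)
qed (simp add: restrict_gens_add distrib_right)

lemma restrict_gens_var: "restrict_gens G (var g) = (if g \<in> G then var g else 0)"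
  by (simp add: var_def restrict_gens_single)

lemma alg_hom_restrict_gens: "alg_hom (free_alg H) (free_alg G) (restrict_gens G)"
  by (auto simp: alg_hom_def ascale_free_alg restrict_gens_add restrict_gens_mult
      restrict_gens_single)
    (auto simp: elts_free_alg in_keys_iff lookup_restrict_gens split: if_splits)

section \<open>Polynomials evaluated at linear operators\<close>

definition lin_ops :: "('k::field, ('a \<Rightarrow> 'k) \<Rightarrow> 'a \<Rightarrow> 'k) nualg" where
  "lin_ops =
     \<lparr>elts = {T. (\<forall>f g. T (\<lambda>x. f x + g x) = (\<lambda>x. T f x + T g x)) \<and>
                 (\<forall>c f. T (\<lambda>x. c * f x) = (\<lambda>x. c * T f x))},
      aadd = (\<lambda>S T f x. S f x + T f x),
      azero = (\<lambda>f x. 0),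
      amult = (\<lambda>S T f. S (T f)),
      ascale = (\<lambda>k T f x. k * T f x)\<rparr>"

lemma na_algebra_lin_ops: "na_algebra lin_ops"
  by standard (auto simp: lin_ops_def algebra_simps)

text \<open>Substitution of the operator \<open>T g\<close> for the letter \<open>g\<close>, a word
  acting as the composite of its letters. The value is taken at a point, so that sums of operators
  become sums of scalars.\<close>

definition eval_ops ::
  "('g \<Rightarrow> ('a \<Rightarrow> 'k) \<Rightarrow> 'a \<Rightarrow> 'k) \<Rightarrow> ('g list \<Rightarrow>\<^sub>0 'k) \<Rightarrow> ('a \<Rightarrow> 'k::field) \<Rightarrow> 'a \<Rightarrow> 'k"
  where
  "eval_ops T p f x = (\<Sum>w\<in>Poly_Mapping.keys p. Poly_Mapping.lookup p w * foldr T w f x)"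

lemma eval_ops_superset:
  assumes "finite S" "Poly_Mapping.keys p \<subseteq> S"
  shows "eval_ops T p f x = (\<Sum>w\<in>S. Poly_Mapping.lookup p w * foldr T w f x)"
  unfolding eval_ops_def using assms by (intro sum.mono_neutral_left) (auto simp: in_keys_iff)

lemma eval_ops_add: "eval_ops T (p + q) f x = eval_ops T p f x + eval_ops T q f x"
proof -
  have "finite (Poly_Mapping.keys p \<union> Poly_Mapping.keys q)"
    by simp
  note superset = eval_ops_superset[OF this]
  show ?thesis
    using keys_add[of p q]
    by (simp add: superset lookup_add distrib_right sum.distrib)
qed

lemma eval_ops_diff: "eval_ops T (p - q) f x = eval_ops T p f x - eval_ops T q f x"
  using eval_ops_add[of T "p - q" q f x] by simp

lemma eval_ops_zero [simp]: "eval_ops T 0 f x = 0"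
  by (simp add: eval_ops_def)

lemma eval_ops_sum: "eval_ops T (sum p S) f x = (\<Sum>i\<in>S. eval_ops T (p i) f x)"
  by (induction S rule: infinite_finite_induct) (simp_all add: eval_ops_add)

lemma eval_ops_single: "eval_ops T (Poly_Mapping.single w c) f x = c * foldr T w f x"
  by (simp add: eval_ops_def)

lemma eval_ops_var: "eval_ops T (var g) f = T g f"
  by (simp add: fun_eq_iff var_def eval_ops_single)

locale linear_generators =
  fixes T :: "'g \<Rightarrow> ('a \<Rightarrow> 'k::field) \<Rightarrow> 'a \<Rightarrow> 'k"
  assumes linear: "T g \<in> elts lin_ops"
begin

lemma foldr_linear: "foldr T w \<in> elts lin_ops"
  using linear by (induction w) (simp_all add: lin_ops_def)

lemma eval_ops_linear: "eval_ops T p \<in> elts lin_ops"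
  using foldr_linear
  by (simp add: lin_ops_def eval_ops_def fun_eq_iff distrib_left sum.distrib sum_distrib_left
      mult.left_commute)

lemma eval_ops_mult: "eval_ops T (p * q) f = eval_ops T p (eval_ops T q f)"
proof (induction p rule: poly_mapping_induct_add)
  case (single u a)
  show ?case
  proof (induction q rule: poly_mapping_induct_add)
    case (single v b)
    have "eval_ops T (Poly_Mapping.single u a) (eval_ops T (Poly_Mapping.single v b) f) =
        (\<lambda>x. a * foldr T u (eval_ops T (Poly_Mapping.single v b) f) x)"
      by (simp add: fun_eq_iff eval_ops_single)
    \<comment> \<open>Linearity of \<open>foldr T u\<close> moves the scalar \<open>b\<close> in
      front of it.\<close>
    also have "foldr T u (eval_ops T (Poly_Mapping.single v b) f) =
        (\<lambda>x. b * foldr T u (foldr T v f) x)"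
      using foldr_linear[of u] by (simp add: eval_ops_single[abs_def] lin_ops_def)
    finally have eq: "eval_ops T (Poly_Mapping.single u a) (eval_ops T (Poly_Mapping.single v b) f) =
        (\<lambda>x. a * (b * foldr T u (foldr T v f) x))" .
    show ?case
      unfolding eq by (simp add: fun_eq_iff mult_single eval_ops_single plus_list_def mult.assoc)
  next
    case (add q q')
    have "eval_ops T (q + q') f = (\<lambda>x. eval_ops T q f x + eval_ops T q' f x)"
      by (simp add: fun_eq_iff eval_ops_add)
    then show ?case
      using add eval_ops_linear[of "Poly_Mapping.single u a"]
      by (simp add: fun_eq_iff distrib_left eval_ops_add lin_ops_def)
  qed
next
  case (add p p')
  then show ?case
    by (simp add: fun_eq_iff distrib_right eval_ops_add)
qed

lemma alg_hom_eval_ops: "alg_hom (free_alg G) lin_ops (eval_ops T)"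
  unfolding alg_hom_def image_subset_iff
proof (intro conjI ballI allI)
  fix p q :: "'g list \<Rightarrow>\<^sub>0 'k" and k :: 'k
  show "eval_ops T p \<in> elts lin_ops"
    by (rule eval_ops_linear)
  show "eval_ops T (aadd (free_alg G) p q) = aadd lin_ops (eval_ops T p) (eval_ops T q)"
    by (simp add: lin_ops_def fun_eq_iff eval_ops_add)
  show "eval_ops T (amult (free_alg G) p q) = amult lin_ops (eval_ops T p) (eval_ops T q)"
    by (simp add: lin_ops_def fun_eq_iff eval_ops_mult)
  show "eval_ops T (ascale (free_alg G) k p) = ascale lin_ops k (eval_ops T p)"
    by (simp add: lin_ops_def fun_eq_iff ascale_free_alg eval_ops_mult eval_ops_single)
qed

end

section \<open>Leavitt path algebras\<close>

lemma gens_mem [simp]: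
  "Vertex v \<in> lpa_gens E \<longleftrightarrow> v \<in> verts E"
  "Edge e \<in> lpa_gens E \<longleftrightarrow> e \<in> arcs E"
  "Ghost e \<in> lpa_gens E \<longleftrightarrow> e \<in> arcs E"
  by (auto simp: lpa_gens_def)

lemma lpa_rels_cases [consumes 1, case_names vertices source range ghost_range ghost_source CK1 CK2]:
  assumes "r \<in> lpa_rels E"
  obtains v w where "v \<in> verts E" "w \<in> verts E"
      "r = var (Vertex v) * var (Vertex w) - (if v = w then var (Vertex v) else 0)"
  | e where "e \<in> arcs E" "r = var (Vertex (tail E e)) * var (Edge e) - var (Edge e)"
  | e where "e \<in> arcs E" "r = var (Edge e) * var (Vertex (head E e)) - var (Edge e)"
  | e where "e \<in> arcs E" "r = var (Vertex (head E e)) * var (Ghost e) - var (Ghost e)"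
  | e where "e \<in> arcs E" "r = var (Ghost e) * var (Vertex (tail E e)) - var (Ghost e)"
  | e f where "e \<in> arcs E" "f \<in> arcs E"
      "r = var (Ghost e) * var (Edge f) - (if e = f then var (Vertex (head E e)) else 0)"
  | v where "regular_vertex E v"
      "r = var (Vertex v) - (\<Sum>e\<in>out_arcs E v. var (Edge e) * var (Ghost e))"
  using assms unfolding lpa_rels_def Un_iff mem_Collect_eq
  by (elim disjE exE conjE)
    (rule that(1), assumption+ | rule that(2), assumption+ | rule that(3), assumption+
      | rule that(4), assumption+ | rule that(5), assumption+ | rule that(6), assumption+
      | rule that(7), assumption+)+

lemma lpa_rels_intros:
  "v \<in> verts E \<Longrightarrow> w \<in> verts E \<Longrightarrow>
     var (Vertex v) * var (Vertex w) - (if v = w then var (Vertex v) else 0) \<in> lpa_rels E"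
  "e \<in> arcs E \<Longrightarrow> var (Vertex (tail E e)) * var (Edge e) - var (Edge e) \<in> lpa_rels E"
  "e \<in> arcs E \<Longrightarrow> var (Edge e) * var (Vertex (head E e)) - var (Edge e) \<in> lpa_rels E"
  "e \<in> arcs E \<Longrightarrow> var (Vertex (head E e)) * var (Ghost e) - var (Ghost e) \<in> lpa_rels E"
  "e \<in> arcs E \<Longrightarrow> var (Ghost e) * var (Vertex (tail E e)) - var (Ghost e) \<in> lpa_rels E"
  "e \<in> arcs E \<Longrightarrow> f \<in> arcs E \<Longrightarrow>
     var (Ghost e) * var (Edge f) - (if e = f then var (Vertex (head E e)) else 0) \<in> lpa_rels E"
  "regular_vertex E v \<Longrightarrow>
     var (Vertex v) - (\<Sum>e\<in>out_arcs E v. var (Edge e) * var (Ghost e)) \<in> lpa_rels E"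
  unfolding lpa_rels_def by blast+

definition lpa_proj ::
  "('v, 'e) pre_digraph \<Rightarrow> (('v, 'e) lpa_gen list \<Rightarrow>\<^sub>0 'k::field) \<Rightarrow> ('v, 'e, 'k) lpa_elem" where
  "lpa_proj E = coset (free_alg (lpa_gens E)) (ideal_gen (free_alg (lpa_gens E)) (lpa_rels E))"

lemma lpa_of_eq: "lpa_of E g = lpa_proj E (var g)"
  by (simp add: lpa_of_def lpa_proj_def)

context wf_digraph
begin

lemma lpa_rels_free: "lpa_rels G \<subseteq> elts (free_alg (lpa_gens G))"
proof
  fix r :: "('a, 'b) lpa_gen list \<Rightarrow>\<^sub>0 'k::field"
  assume "r \<in> lpa_rels G"
  then show "r \<in> elts (free_alg (lpa_gens G))"
    by (cases rule: lpa_rels_cases)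
      (auto simp: regular_vertex_def intro!: free_alg_diff_closed free_alg_sum_closed)
qed

lemma na_ideal_rels:
  "na_ideal (free_alg (lpa_gens G)) (ideal_gen (free_alg (lpa_gens G)) (lpa_rels G))"
  by (intro na_ideal.intro na_ideal_axioms.intro na_algebra_free_alg
      na_algebra.alg_ideal_ideal_gen lpa_rels_free)

lemma na_algebra_lpa: "na_algebra (lpa G)"
  unfolding lpa_def by (rule na_ideal.na_algebra_quot[OF na_ideal_rels])

lemma na_hom_lpa_proj: "na_hom (free_alg (lpa_gens G)) (lpa G) (lpa_proj G)"
  by (intro na_hom.intro na_hom_axioms.intro na_algebra_free_alg na_algebra_lpa)
    (simp add: lpa_def lpa_proj_def na_ideal.alg_hom_coset[OF na_ideal_rels])

lemma elts_lpa: "elts (lpa G) = lpa_proj G ` elts (free_alg (lpa_gens G))"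
  by (simp add: lpa_def lpa_proj_def na_ideal.quot_elts[OF na_ideal_rels])

lemma lpa_proj_eq_zero_iff:
  "p \<in> elts (free_alg (lpa_gens G)) \<Longrightarrow>
     lpa_proj G p = azero (lpa G) \<longleftrightarrow> p \<in> ideal_gen (free_alg (lpa_gens G)) (lpa_rels G)"
  by (simp add: lpa_def lpa_proj_def na_ideal.quot_eq_zero_iff[OF na_ideal_rels])

lemma lpa_proj_zero: "lpa_proj G 0 = azero (lpa G)"
  by (rule na_hom.hom_zero[OF na_hom_lpa_proj, simplified])

lemma lpa_proj_rel: "r \<in> lpa_rels G \<Longrightarrow> lpa_proj G r = azero (lpa G)"
  by (simp add: lpa_proj_eq_zero_iff subsetD[OF lpa_rels_free] subsetD[OF subset_ideal_gen])

lemma lpa_of_in_lpa: "g \<in> lpa_gens G \<Longrightarrow> lpa_of G g \<in> elts (lpa G)"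
  by (simp add: lpa_of_eq elts_lpa)

text \<open>The universal property of the Leavitt path algebra. It yields the representation on
  functions and both directions of the canonical isomorphism.\<close>

lemma lpa_factor:
  fixes f :: "(('a, 'b) lpa_gen list \<Rightarrow>\<^sub>0 'k::field) \<Rightarrow> 'c"
  assumes "na_algebra B" "alg_hom (free_alg (lpa_gens G)) B f"
    and "\<And>r. r \<in> lpa_rels G \<Longrightarrow> f r = azero B"
  obtains h where "alg_hom (lpa G) B h"
    "\<And>p. p \<in> elts (free_alg (lpa_gens G)) \<Longrightarrow> h (lpa_proj G p) = f p"
proof -
  interpret na_hom "free_alg (lpa_gens G)" B f
    by (intro na_hom.intro na_hom_axioms.intro na_algebra_free_alg assms)
  show ?thesis
  proof (rule alg_quot_factor[OF na_ideal.ideal[OF na_ideal_rels]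
        hom_ideal_gen_eq_zero[OF lpa_rels_free assms(3)], folded lpa_def lpa_proj_def])
    fix h
    assume "alg_hom (lpa G) B h"
      "\<And>p. p \<in> elts (free_alg (lpa_gens G)) \<Longrightarrow> h (lpa_proj G p) = f p"
    then show thesis
      by (rule that)
  qed
qed

text \<open>The projection is surjective and so carries generated ideals to generated ideals.
  Elements of the vertex ideal thereby come from polynomials, at which the canonical map can be
  computed.\<close>

lemma vertex_ideal_eq:
  assumes "H \<subseteq> verts G"
  shows "(vertex_ideal G H :: ('a, 'b, 'k::field) lpa_elem set) =
    lpa_proj G ` ideal_gen (free_alg (lpa_gens G)) ((\<lambda>v. var (Vertex v)) ` H)"
proof -
  interpret na_hom "free_alg (lpa_gens G)" "lpa G"
      "lpa_proj G :: _ \<Rightarrow> ('a, 'b, 'k) lpa_elem"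
    by (rule na_hom_lpa_proj)
  have "(\<lambda>v. var (Vertex v) :: _ \<Rightarrow>\<^sub>0 'k) ` H \<subseteq> elts (free_alg (lpa_gens G))"
    using assms by auto
  from image_ideal_gen[OF elts_lpa[symmetric] this] show ?thesis
    by (simp add: vertex_ideal_def lpa_of_eq image_image)
qed

lemma alg_ideal_vertex_ideal: "H \<subseteq> verts G \<Longrightarrow> alg_ideal (lpa G) (vertex_ideal G H)"
  unfolding vertex_ideal_def
  by (rule na_algebra.alg_ideal_ideal_gen[OF na_algebra_lpa]) (auto intro!: lpa_of_in_lpa)

lemma hereditaryD:
  assumes "hereditary G H" "e \<in> arcs G" "tail G e \<in> H"
  shows "head G e \<in> H"
proof -
  have "tail G e \<rightarrow>\<^sup>*\<^bsub>G\<^esub> head G e"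
    using assms(2) by (intro reachable_adjI in_arcs_imp_in_arcs_ends)
  then show ?thesis
    using assms by (auto simp: hereditary_def)
qed

lemma hereditaryI:
  assumes "\<And>e. e \<in> arcs G \<Longrightarrow> tail G e \<in> H \<Longrightarrow> head G e \<in> H"
  shows "hereditary G H"
  unfolding hereditary_def
proof (intro ballI allI impI)
  fix v w assume "v \<in> H" "v \<rightarrow>\<^sup>*\<^bsub>G\<^esub> w"
  from this(2,1) show "w \<in> H"
    unfolding reachable_def
  proof (induction rule: rtrancl_on.induct)
    case (rtrancl_on_into_rtrancl_on v u w)
    then obtain e where "e \<in> arcs G" "tail G e = u" "head G e = w"
      by (auto simp: arcs_ends_def arc_to_ends_def)
    then show ?case
      using assms[of e] rtrancl_on_into_rtrancl_on by auto
  qed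
qed

end

text \<open>Such ideals correspond to the ideals of the Leavitt path algebra. Each relation is a
  difference of two polynomials, which \<open>cong_mem\<close> turns into an equivalence between
  memberships in \<open>J\<close>.\<close>

locale lpa_free_ideal = wf_digraph G + na_ideal "free_alg (lpa_gens G)" J
  for G :: "('v, 'e) pre_digraph" and J :: "(('v, 'e) lpa_gen list \<Rightarrow>\<^sub>0 'k::field) set" +
  assumes rels_mem: "lpa_rels G \<subseteq> J"
begin

lemma plus_mem: "p \<in> J \<Longrightarrow> q \<in> J \<Longrightarrow> p + q \<in> J"
  using ideal_add[of p q] by simp

lemma minus_mem: "p \<in> J \<Longrightarrow> q \<in> J \<Longrightarrow> p - q \<in> J"
  using ideal_scale[of q "- 1"] plus_mem[of p "- q"]
  by (simp add: ascale_free_alg single_Nil_minus_one)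

lemma mult_left_mem: "p \<in> elts (free_alg (lpa_gens G)) \<Longrightarrow> q \<in> J \<Longrightarrow> p * q \<in> J"
  and mult_right_mem: "p \<in> elts (free_alg (lpa_gens G)) \<Longrightarrow> q \<in> J \<Longrightarrow> q * p \<in> J"
  using ideal_mult[of p q] by simp_all

lemma sum_mem: "(\<And>i. i \<in> S \<Longrightarrow> p i \<in> J) \<Longrightarrow> sum p S \<in> J"
proof (induction S rule: infinite_finite_induct)
  case empty
  then show ?case
    using ideal_zero by simp
next
  case infinite
  then show ?case
    using ideal_zero by simp
qed (simp add: plus_mem)

lemma cong_mem: "p - q \<in> J \<Longrightarrow> p \<in> J \<longleftrightarrow> q \<in> J"
  using minus_mem[of p "p - q"] plus_mem[of "p - q" q] by auto

lemmas rel_mem = subsetD[OF rels_mem]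

lemma Edge_mem_if_tail:
  assumes "e \<in> arcs G" "var (Vertex (tail G e)) \<in> J"
  shows "var (Edge e) \<in> J"
  using cong_mem[OF rel_mem[OF lpa_rels_intros(2)[OF assms(1)]]] assms
  by (simp add: mult_right_mem)

lemma Edge_mem_if_head:
  assumes "e \<in> arcs G" "var (Vertex (head G e)) \<in> J"
  shows "var (Edge e) \<in> J"
  using cong_mem[OF rel_mem[OF lpa_rels_intros(3)[OF assms(1)]]] assms
  by (simp add: mult_left_mem)

lemma Ghost_mem_if_head:
  assumes "e \<in> arcs G" "var (Vertex (head G e)) \<in> J"
  shows "var (Ghost e) \<in> J"
  using cong_mem[OF rel_mem[OF lpa_rels_intros(4)[OF assms(1)]]] assms
  by (simp add: mult_right_mem)

lemma head_mem_if_Edge: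
  assumes "e \<in> arcs G" "var (Edge e) \<in> J"
  shows "var (Vertex (head G e)) \<in> J"
  using cong_mem[OF rel_mem[OF lpa_rels_intros(6)[OF assms(1,1)]]] assms
  by (simp add: mult_left_mem)

lemma Vertex_mem_if_Edges:
  assumes "regular_vertex G v" "\<And>e. e \<in> out_arcs G v \<Longrightarrow> var (Edge e) \<in> J"
  shows "var (Vertex v) \<in> J"
proof -
  have "(\<Sum>e\<in>out_arcs G v. var (Edge e) * var (Ghost e)) \<in> J"
    using assms(2) by (intro sum_mem mult_right_mem) auto
  then show ?thesis
    using cong_mem[OF rel_mem[OF lpa_rels_intros(7)[OF assms(1)]]] by simp
qed

end

context wf_digraph
begin

text \<open>If v is in the ideal, so is e = v e for each edge e leaving v, and so is r(e) = e* e. If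
  v is regular and all heads r(e) are in the ideal, so is each e = e r(e), and hence v, the sum of
  the products e e* over these edges.\<close>

lemma her_sat_vertices_of_ideal:
  fixes I :: "('a, 'b, 'k::field) lpa_elem set"
  assumes "alg_ideal (lpa G) I"
  shows "her_sat G {v \<in> verts G. lpa_of G (Vertex v) \<in> I}"
proof -
  interpret P: na_hom "free_alg (lpa_gens G)" "lpa G" "lpa_proj G :: _ \<Rightarrow> ('a, 'b, 'k) lpa_elem"
    by (rule na_hom_lpa_proj)
  define J where "J = {p \<in> elts (free_alg (lpa_gens G)). lpa_proj G p \<in> I}"
  have zero: "azero (lpa G) \<in> I"
    using assms by (simp add: alg_ideal_def)
  have ideal_J: "alg_ideal (free_alg (lpa_gens G)) J"
    unfolding J_def using assms by (rule P.alg_ideal_preimage)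
  have rels_J: "lpa_rels G \<subseteq> J"
    using zero lpa_rels_free by (auto simp: J_def lpa_proj_rel)
  have mem: "var (Vertex v) \<in> J \<longleftrightarrow> v \<in> {v \<in> verts G. lpa_of G (Vertex v) \<in> I}" for v
    by (simp add: J_def lpa_of_eq)
  interpret lpa_free_ideal G J
    by (intro lpa_free_ideal.intro na_ideal.intro na_ideal_axioms.intro
        lpa_free_ideal_axioms.intro wf_digraph_axioms na_algebra_free_alg ideal_J rels_J)
  show ?thesis
    unfolding her_sat_def
  proof (intro conjI)
    show "hereditary G {v \<in> verts G. lpa_of G (Vertex v) \<in> I}"
      by (rule hereditaryI) (simp only: mem[symmetric] Edge_mem_if_tail head_mem_if_Edge)
    show "saturated G {v \<in> verts G. lpa_of G (Vertex v) \<in> I}"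
      unfolding saturated_def
    proof (intro allI impI)
      fix v
      assume v: "regular_vertex G v \<and>
        head G ` out_arcs G v \<subseteq> {v \<in> verts G. lpa_of G (Vertex v) \<in> I}"
      have "var (Edge e) \<in> J" if "e \<in> out_arcs G v" for e
      proof (rule Edge_mem_if_head)
        show "e \<in> arcs G"
          using that by simp
        show "var (Vertex (head G e)) \<in> J"
          using v that unfolding mem by blast
      qed
      then show "v \<in> {v \<in> verts G. lpa_of G (Vertex v) \<in> I}"
        using v Vertex_mem_if_Edges[of v] unfolding mem by blast
    qed
  qed auto
qed

end

section \<open>Quotients by hereditary and saturated sets\<close>

locale her_sat_graph = wf_digraph G for G :: "('v, 'e) pre_digraph" +
  fixes H :: "'v set"
  assumes row_finite: "row_finite G" and her_sat: "her_sat G H"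
begin

abbreviation "Q \<equiv> quot_graph G H"

lemma quot_simps [simp]:
  "verts Q = verts G - H" "tail Q = tail G" "head Q = head G"
  "e \<in> arcs Q \<longleftrightarrow> e \<in> arcs G \<and> head G e \<notin> H"
  by (simp_all add: quot_graph_def)

lemma out_arcs_quot: "out_arcs Q v = {e \<in> out_arcs G v. head G e \<notin> H}"
  by auto

lemma H_verts: "H \<subseteq> verts G" and H_hereditary: "hereditary G H" and H_saturated: "saturated G H"
  using her_sat by (simp_all add: her_sat_def)

lemma head_in_H: "e \<in> arcs G \<Longrightarrow> tail G e \<in> H \<Longrightarrow> head G e \<in> H"
  using H_hereditary by (rule hereditaryD)

text \<open>An edge that ends outside \<open>H\<close> also starts outside \<open>H\<close>, because
  \<open>H\<close> is hereditary.\<close>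

sublocale Q: wf_digraph Q
  by unfold_locales (use head_in_H in auto)

lemma finite_out_arcs: "finite (out_arcs G v)"
proof (cases "v \<in> verts G")
  case True
  then show ?thesis
    using row_finite by (simp add: row_finite_def)
next
  case False
  then have "out_arcs G v = {}"
    by (auto simp: out_arcs_def)
  then show ?thesis
    by simp
qed

lemma finite_out_arcs_quot: "finite (out_arcs Q v)"
  by (rule finite_subset[OF _ finite_out_arcs[of v]]) auto

lemma out_arcs_quot_nonempty: "regular_vertex G v \<Longrightarrow> v \<notin> H \<Longrightarrow> out_arcs Q v \<noteq> {}"
  using H_saturated unfolding saturated_def out_arcs_quot by blast

text \<open>A regular vertex all of whose edges end in \<open>H\<close> is in \<open>H\<close> by
  saturation. Hence both graphs impose the relation v = sum of e e* at the same vertices outside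
  \<open>H\<close>.\<close>

lemma regular_quot_iff: "v \<notin> H \<Longrightarrow> regular_vertex Q v \<longleftrightarrow> regular_vertex G v"
  using out_arcs_quot_nonempty[of v] finite_out_arcs[of v] finite_out_arcs_quot[of v]
  by (auto simp: regular_vertex_def out_arcs_quot)

lemma her_sat_quot:
  assumes Y: "her_sat G Y" and "H \<subseteq> Y"
  shows "her_sat Q (Y - H)"
  unfolding her_sat_def
proof (intro conjI)
  show "Y - H \<subseteq> verts Q"
    using Y by (auto simp: her_sat_def)
  show "hereditary Q (Y - H)"
    using Y hereditaryD[of Y] by (intro Q.hereditaryI) (auto simp: her_sat_def)
  show "saturated Q (Y - H)"
    unfolding saturated_def
  proof (intro allI impI, elim conjE)
    fix v assume v: "regular_vertex Q v" "head Q ` out_arcs Q v \<subseteq> Y - H"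
    then have "v \<notin> H"
      by (simp add: regular_vertex_def)
    \<comment> \<open>An edge of \<open>G\<close> from \<open>v\<close> either survives in the
      quotient graph or ends in \<open>H\<close>.\<close>
    moreover have "head G e \<in> Y" if "e \<in> out_arcs G v" for e
      using that v(2) \<open>H \<subseteq> Y\<close> by (cases "head G e \<in> H") (auto simp: image_subset_iff)
    ultimately show "v \<in> Y - H"
      using Y v(1) by (auto simp: her_sat_def saturated_def regular_quot_iff)
  qed
qed

lemma her_sat_union:
  assumes Z: "her_sat Q Z"
  shows "her_sat G (H \<union> Z)"
  unfolding her_sat_def
proof (intro conjI)
  show "H \<union> Z \<subseteq> verts G"
    using Z H_verts by (auto simp: her_sat_def)
  show "hereditary G (H \<union> Z)"
  proof (rule hereditaryI)
    fix e assume e: "e \<in> arcs G" "tail G e \<in> H \<union> Z"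
    show "head G e \<in> H \<union> Z"
      using Z e head_in_H[of e] Q.hereditaryD[of Z e] by (auto simp: her_sat_def)
  qed
  show "saturated G (H \<union> Z)"
    unfolding saturated_def
  proof (intro allI impI, elim conjE)
    fix v assume v: "regular_vertex G v" "head G ` out_arcs G v \<subseteq> H \<union> Z"
    show "v \<in> H \<union> Z"
    proof (cases "v \<in> H")
      case False
      moreover have "head Q ` out_arcs Q v \<subseteq> Z"
        using v(2) by (auto simp: image_subset_iff)
      ultimately show ?thesis
        using Z v(1) by (auto simp: her_sat_def saturated_def regular_quot_iff)
    qed simp
  qed
qed

text \<open>
  The Leavitt path algebra acts on the functions on \<open>V \<times> \<nat>\<close>: for the \<open>k\<close> edges \<open>e\<close> that leave \<open>v\<close>
  in the quotient graph, the maps \<open>(r(e), m) \<mapsto> (v, k m + idx e)\<close> are injective, and their ranges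
  partition \<open>{v} \<times> \<nat>\<close>. The vertices in \<open>H\<close> act as zero, and no other vertex does.
\<close>

definition deg :: "'v \<Rightarrow> nat" where
  "deg v = card (out_arcs Q v)"

text \<open>The bijection is chosen for the vertex \<open>tail G e\<close>, so edges with the same
  source are numbered by the same choice.\<close>

definition idx :: "'e \<Rightarrow> nat" where
  "idx e = (SOME h. bij_betw h (out_arcs Q (tail G e)) {0..<deg (tail G e)}) e"

text \<open>\<open>Edge e\<close> transports a function along the injection of \<open>e\<close> and
  extends it by zero; \<open>Ghost e\<close> pulls it back. Quotient and remainder by
  \<open>deg\<close> invert the injection.\<close>

fun rep :: "('v, 'e) lpa_gen \<Rightarrow> ('v \<times> nat \<Rightarrow> 'k::field) \<Rightarrow> 'v \<times> nat \<Rightarrow> 'k" where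
  "rep (Vertex v) f (u, m) = (if u = v \<and> v \<notin> H then f (u, m) else 0)"
| "rep (Edge e) f (u, m) =
     (if e \<in> out_arcs Q u \<and> m mod deg u = idx e then f (head G e, m div deg u) else 0)"
| "rep (Ghost e) f (u, m) =
     (if e \<in> arcs Q \<and> u = head G e then f (tail G e, deg (tail G e) * m + idx e) else 0)"

lemma bij_betw_idx: "bij_betw idx (out_arcs Q v) {0..<deg v}"
proof -
  define h where "h = (SOME h. bij_betw h (out_arcs Q v) {0..<deg v})"
  have "bij_betw h (out_arcs Q v) {0..<deg v}"
    unfolding h_def deg_def
    using ex_bij_betw_finite_nat[OF finite_out_arcs_quot] by (rule someI_ex)
  moreover have "idx e = h e" if "e \<in> out_arcs Q v" for e
    using that by (simp add: idx_def h_def)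
  ultimately show ?thesis
    using bij_betw_cong[of "out_arcs Q v" idx h "{0..<deg v}"] by blast
qed

lemma idx_less: "e \<in> arcs Q \<Longrightarrow> idx e < deg (tail G e)"
  using bij_betw_idx[of "tail G e"] by (auto simp: bij_betw_def)

lemma idx_eq_iff:
  "e \<in> arcs Q \<Longrightarrow> f \<in> arcs Q \<Longrightarrow> tail G e = tail G f \<Longrightarrow> idx e = idx f \<longleftrightarrow> e = f"
  using bij_betw_idx[of "tail G e"] by (auto simp: bij_betw_def inj_on_def)

lemma rep_linear: "(rep g :: ('v \<times> nat \<Rightarrow> 'k::field) \<Rightarrow> _) \<in> elts lin_ops"
  by (cases g) (auto simp: lin_ops_def fun_eq_iff)

sublocale rep: linear_generators "rep :: _ \<Rightarrow> ('v \<times> nat \<Rightarrow> 'k::field) \<Rightarrow> _"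
  by unfold_locales (rule rep_linear)

lemma rep_partition:
  assumes "regular_vertex G v"
  shows "(\<Sum>e\<in>out_arcs G v. rep (Edge e) (rep (Ghost e) f) (u, m)) = rep (Vertex v) f (u, m)"
proof (cases "u = v \<and> v \<notin> H")
  case False
  \<comment> \<open>Either the point lies over another vertex, or \<open>v\<close> is in
    \<open>H\<close> and all its edges end in \<open>H\<close>, so they are missing from the
    quotient graph.\<close>
  have "rep (Edge e) (rep (Ghost e) f) (u, m) = 0" if "e \<in> out_arcs G v" for e
    using False that head_in_H[of e] by auto
  then show ?thesis
    using False by (auto intro!: sum.neutral)
next
  case True
  then have "out_arcs Q v \<noteq> {}"
    using assms out_arcs_quot_nonempty by blast
  then have "m mod deg v \<in> {0..<deg v}"
    using finite_out_arcs_quot[of v] by (simp add: deg_def card_gt_0_iff)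
  then have "m mod deg v \<in> idx ` out_arcs Q v"
    using bij_betw_idx[of v] by (simp add: bij_betw_def)
  then obtain e where e: "e \<in> out_arcs Q v" "idx e = m mod deg v"
    by (metis imageE)
  \<comment> \<open>If \<open>m\<close> has remainder \<open>idx e'\<close>, then
    \<open>deg v * (m div deg v) + idx e'\<close> is \<open>m\<close> again, and the value of
    \<open>f\<close> is kept; otherwise the result is zero.\<close>
  have "rep (Edge e') (rep (Ghost e') f) (u, m) = (if e' = e then f (u, m) else 0)"
    if "e' \<in> out_arcs G v" for e'
    using that True e idx_eq_iff[of e' e] by auto
  then have "(\<Sum>e'\<in>out_arcs G v. rep (Edge e') (rep (Ghost e') f) (u, m)) =
      (\<Sum>e'\<in>out_arcs G v. if e' = e then f (u, m) else 0)"
    by (intro sum.cong) auto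
  also have "\<dots> = f (u, m)"
    using e finite_out_arcs by auto
  finally show ?thesis
    using True by simp
qed

text \<open>Edges with tail in \<open>H\<close> have their head in \<open>H\<close> and act as zero,
  in accordance with the zero action of the tail. For e* f with a common tail, the bound on
  \<open>idx e\<close> gives back quotient and remainder, and injectivity of \<open>idx\<close>
  separates different edges.\<close>

lemma rep_rels:
  assumes "r \<in> lpa_rels G"
  shows "eval_ops rep r f (u, m) = (0 :: 'k::field)"
  using assms
proof (cases rule: lpa_rels_cases)
  case (vertices v w)
  then show ?thesis
    by (auto simp: eval_ops_diff rep.eval_ops_mult eval_ops_var)
next
  case (source e)
  then show ?thesis
    using head_in_H[of e] by (auto simp: eval_ops_diff rep.eval_ops_mult eval_ops_var)
next
  case (range e)
  then show ?thesis
    by (auto simp: eval_ops_diff rep.eval_ops_mult eval_ops_var)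
next
  case (ghost_range e)
  then show ?thesis
    by (auto simp: eval_ops_diff rep.eval_ops_mult eval_ops_var)
next
  case (ghost_source e)
  then show ?thesis
    using head_in_H[of e] by (auto simp: eval_ops_diff rep.eval_ops_mult eval_ops_var)
next
  case (CK1 e e')
  then show ?thesis
    using idx_less[of e] idx_eq_iff[of e e']
    by (auto simp: eval_ops_diff rep.eval_ops_mult eval_ops_var)
next
  case (CK2 v)
  then show ?thesis
    using rep_partition[of v f u m]
    by (simp add: eval_ops_diff eval_ops_sum rep.eval_ops_mult eval_ops_var del: rep.simps)
qed

lemma vertex_in_vertex_ideal_iff:
  assumes v: "v \<in> verts G"
  shows "(lpa_of G (Vertex v) :: ('v, 'e, 'k::field) lpa_elem) \<in> vertex_ideal G H \<longleftrightarrow> v \<in> H"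
proof
  assume mem: "(lpa_of G (Vertex v) :: ('v, 'e, 'k) lpa_elem) \<in> vertex_ideal G H"
  let ?ev = "eval_ops rep :: _ \<Rightarrow> ('v \<times> nat \<Rightarrow> 'k) \<Rightarrow> 'v \<times> nat \<Rightarrow> 'k"
  have zero: "?ev r = azero lin_ops" if "r \<in> lpa_rels G" for r
    using rep_rels[OF that] by (simp add: lin_ops_def fun_eq_iff)
  obtain h where h: "alg_hom (lpa G) lin_ops h"
    "\<And>p. p \<in> elts (free_alg (lpa_gens G)) \<Longrightarrow> h (lpa_proj G p) = ?ev p"
    by (rule lpa_factor[OF na_algebra_lin_ops rep.alg_hom_eval_ops zero]) (assumption | rule that)+
  interpret h: na_hom "lpa G" lin_ops h
    by (intro na_hom.intro na_hom_axioms.intro na_algebra_lpa na_algebra_lin_ops h)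
  have h_vertex: "h (lpa_of G (Vertex w)) = rep (Vertex w)" if "w \<in> verts G" for w
    using that by (simp add: lpa_of_eq h(2) fun_eq_iff eval_ops_var)
  have "h (lpa_of G (Vertex v)) = azero lin_ops"
  proof (rule h.hom_ideal_gen_eq_zero[OF _ _ mem[unfolded vertex_ideal_def]])
    show "(\<lambda>w. lpa_of G (Vertex w)) ` H \<subseteq> elts (lpa G)"
      using H_verts by (auto intro!: lpa_of_in_lpa)
    show "h x = azero lin_ops" if "x \<in> (\<lambda>w. lpa_of G (Vertex w)) ` H" for x
      using that H_verts by (auto simp: h_vertex lin_ops_def fun_eq_iff)
  qed
  \<comment> \<open>A vertex outside \<open>H\<close> acts as the identity over itself, which the
    constant function 1 detects at \<open>(v, 0)\<close>.\<close>
  then have "rep (Vertex v) (\<lambda>_. 1 :: 'k) (v, 0) = 0"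
    using v by (simp add: h_vertex lin_ops_def)
  then show "v \<in> H"
    by (simp split: if_splits)
next
  assume "v \<in> H"
  then show "(lpa_of G (Vertex v) :: ('v, 'e, 'k) lpa_elem) \<in> vertex_ideal G H"
    unfolding vertex_ideal_def using subset_ideal_gen by fast
qed

end

section \<open>The canonical isomorphism\<close>

lemma insert_image_if: "insert z ((\<lambda>x. if x \<in> B then z else g x) ` C) = insert z (g ` (C - B))"
  by auto

context her_sat_graph
begin

lemma na_ideal_vertex_ideal: "na_ideal (lpa G) (vertex_ideal G H)"
  by (intro na_ideal.intro na_ideal_axioms.intro na_algebra_lpa alg_ideal_vertex_ideal H_verts)

lemma na_hom_lpa_class: "na_hom (lpa G) (lpa_quot G H) (lpa_class G H)"
  unfolding lpa_quot_def lpa_class_def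
  by (intro na_hom.intro na_hom_axioms.intro na_algebra_lpa
      na_ideal.na_algebra_quot[OF na_ideal_vertex_ideal]
      na_ideal.alg_hom_coset[OF na_ideal_vertex_ideal])

lemma na_algebra_lpa_quot: "na_algebra (lpa_quot G H)"
  using na_hom_lpa_class by (rule na_hom.axioms(2))

text \<open>With \<open>to_quot_graph\<close> this presents both algebras as images of one free
  algebra. The canonical isomorphism turns \<open>to_quot p\<close> into
  \<open>to_quot_graph p\<close>, so questions about it become questions about polynomials.\<close>

definition to_quot ::
  "(('v, 'e) lpa_gen list \<Rightarrow>\<^sub>0 'k::field) \<Rightarrow> ('v, 'e, 'k) lpa_elem set" where
  "to_quot p = lpa_class G H (lpa_proj G p)"

definition to_quot_graph ::
  "(('v, 'e) lpa_gen list \<Rightarrow>\<^sub>0 'k::field) \<Rightarrow> ('v, 'e, 'k) lpa_elem" where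
  "to_quot_graph p = lpa_proj Q (restrict_gens (lpa_gens Q) p)"

lemma na_hom_to_quot: "na_hom (free_alg (lpa_gens G)) (lpa_quot G H) to_quot"
proof -
  have "alg_hom (free_alg (lpa_gens G)) (lpa_quot G H) (lpa_class G H \<circ> lpa_proj G)"
    using na_hom.hom[OF na_hom_lpa_proj] na_hom.hom[OF na_hom_lpa_class] by (rule alg_hom_comp)
  then show ?thesis
    by (intro na_hom.intro na_hom_axioms.intro na_algebra_free_alg na_algebra_lpa_quot)
      (simp add: to_quot_def[abs_def] comp_def)
qed

lemma na_hom_to_quot_graph: "na_hom (free_alg (lpa_gens G)) (lpa Q) to_quot_graph"
proof -
  have "alg_hom (free_alg (lpa_gens G)) (lpa Q) (lpa_proj Q \<circ> restrict_gens (lpa_gens Q))"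
    using alg_hom_restrict_gens na_hom.hom[OF Q.na_hom_lpa_proj] by (rule alg_hom_comp)
  then show ?thesis
    by (intro na_hom.intro na_hom_axioms.intro na_algebra_free_alg Q.na_algebra_lpa)
      (simp add: to_quot_graph_def[abs_def] comp_def)
qed

lemma elts_lpa_quot: "elts (lpa_quot G H) = to_quot ` elts (free_alg (lpa_gens G))"
  by (simp add: lpa_quot_def na_ideal.quot_elts[OF na_ideal_vertex_ideal] elts_lpa image_image
      to_quot_def[abs_def] lpa_class_def)

lemma lpa_gens_quot_subset: "lpa_gens Q \<subseteq> lpa_gens G"
  by (auto simp: lpa_gens_def)

lemma free_alg_quot_subset: "elts (free_alg (lpa_gens Q)) \<subseteq> elts (free_alg (lpa_gens G))"
  using lpa_gens_quot_subset by (rule free_alg_mono)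

lemma restrict_gens_quot:
  assumes "p \<in> elts (free_alg (lpa_gens Q))"
  shows "restrict_gens (lpa_gens Q) p = p"
proof (rule poly_mapping_eqI)
  fix w
  show "Poly_Mapping.lookup (restrict_gens (lpa_gens Q) p) w = Poly_Mapping.lookup p w"
    using assms by (cases "w \<in> Poly_Mapping.keys p")
      (auto simp: lookup_restrict_gens elts_free_alg in_keys_iff)
qed

text \<open>In all relations but the last kind, a deleted letter makes every term vanish; an edge
  that survives keeps its tail, as \<open>H\<close> is hereditary. In the last kind only the edges
  into \<open>H\<close> drop out of the sum.\<close>

lemma restrict_gens_rel:
  fixes r :: "('v, 'e) lpa_gen list \<Rightarrow>\<^sub>0 'k::field"
  assumes "r \<in> lpa_rels G"
  shows "restrict_gens (lpa_gens Q) r \<in> insert 0 (lpa_rels Q)"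
  using assms
proof (cases rule: lpa_rels_cases)
  case (vertices v w)
  then show ?thesis
    using lpa_rels_intros(1)[of v Q w]
    by (auto simp: restrict_gens_diff restrict_gens_mult restrict_gens_var)
next
  case (source e)
  then show ?thesis
    using head_in_H[of e] lpa_rels_intros(2)[of e Q]
    by (auto simp: restrict_gens_diff restrict_gens_mult restrict_gens_var)
next
  case (range e)
  then show ?thesis
    using lpa_rels_intros(3)[of e Q]
    by (auto simp: restrict_gens_diff restrict_gens_mult restrict_gens_var)
next
  case (ghost_range e)
  then show ?thesis
    using lpa_rels_intros(4)[of e Q]
    by (auto simp: restrict_gens_diff restrict_gens_mult restrict_gens_var)
next
  case (ghost_source e)
  then show ?thesis
    using head_in_H[of e] lpa_rels_intros(5)[of e Q]
    by (auto simp: restrict_gens_diff restrict_gens_mult restrict_gens_var)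
next
  case (CK1 e f)
  then show ?thesis
    using lpa_rels_intros(6)[of e Q f]
    by (auto simp: restrict_gens_diff restrict_gens_mult restrict_gens_var)
next
  case (CK2 v)
  have "(\<Sum>e\<in>out_arcs G v. restrict_gens (lpa_gens Q) (var (Edge e) * var (Ghost e))) =
      (\<Sum>e\<in>out_arcs Q v. var (Edge e) * var (Ghost e) ::
        ('v, 'e) lpa_gen list \<Rightarrow>\<^sub>0 'k)"
    using finite_out_arcs
    by (intro sum.mono_neutral_cong_right) (auto simp: restrict_gens_mult restrict_gens_var)
  then have eq: "restrict_gens (lpa_gens Q) r =
      (if v \<in> H then 0 else var (Vertex v)) - (\<Sum>e\<in>out_arcs Q v. var (Edge e) * var (Ghost e))"
    using CK2 by (auto simp: restrict_gens_diff restrict_gens_sum restrict_gens_var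
        regular_vertex_def)
  show ?thesis
  \<comment> \<open>For \<open>v\<close> in \<open>H\<close> all edges are deleted and the relation
    becomes 0; otherwise saturation keeps \<open>v\<close> regular.\<close>
  proof (cases "v \<in> H")
    case True
    then have "out_arcs Q v = {}"
      using head_in_H by auto
    then show ?thesis
      using True eq by simp
  next
    case False
    then show ?thesis
      using CK2(1) by (simp add: eq lpa_rels_intros(7) regular_quot_iff)
  qed
qed

lemma to_quot_graph_rel:
  assumes "r \<in> lpa_rels G"
  shows "to_quot_graph r = azero (lpa Q)"
  using restrict_gens_rel[OF assms]
  by (auto simp: to_quot_graph_def Q.lpa_proj_zero Q.lpa_proj_rel)

lemma to_quot_graph_var:
  "to_quot_graph (var g) = (if g \<in> lpa_gens Q then lpa_of Q g else azero (lpa Q))"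
  by (simp add: to_quot_graph_def restrict_gens_var lpa_of_eq Q.lpa_proj_zero)

lemma to_quot_graph_surj: "to_quot_graph ` elts (free_alg (lpa_gens G)) = elts (lpa Q)"
proof
  show "to_quot_graph ` elts (free_alg (lpa_gens G)) \<subseteq> elts (lpa Q)"
    using na_hom.hom_closed[OF na_hom_to_quot_graph] by auto
  show "elts (lpa Q) \<subseteq> to_quot_graph ` elts (free_alg (lpa_gens G))"
    unfolding Q.elts_lpa using free_alg_quot_subset
    by (force simp: to_quot_graph_def restrict_gens_quot)
qed

lemma lpa_free_ideal_kernel:
  "lpa_free_ideal G {p \<in> elts (free_alg (lpa_gens G)). to_quot p = azero (lpa_quot G H)}"
proof (intro lpa_free_ideal.intro na_ideal.intro na_ideal_axioms.intro
    lpa_free_ideal_axioms.intro wf_digraph_axioms na_algebra_free_alg)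
  show "alg_ideal (free_alg (lpa_gens G))
      {p \<in> elts (free_alg (lpa_gens G)). to_quot p = azero (lpa_quot G H)}"
    using na_hom_to_quot by (rule na_hom.alg_ideal_kernel)
  show "lpa_rels G \<subseteq> {p \<in> elts (free_alg (lpa_gens G)). to_quot p = azero (lpa_quot G H)}"
    using lpa_rels_free na_hom.hom_zero[OF na_hom_lpa_class]
    by (auto simp: to_quot_def lpa_proj_rel)
qed

lemma to_quot_Vertex:
  assumes "v \<in> H"
  shows "to_quot (var (Vertex v)) = (azero (lpa_quot G H) :: ('v, 'e, 'k::field) lpa_elem set)"
proof -
  have "(lpa_of G (Vertex v) :: ('v, 'e, 'k) lpa_elem) \<in> vertex_ideal G H"
    unfolding vertex_ideal_def using assms subset_ideal_gen by fast
  then show ?thesis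
    unfolding to_quot_def lpa_quot_def lpa_class_def lpa_of_eq[symmetric]
    using assms H_verts
    by (subst na_ideal.quot_eq_zero_iff[OF na_ideal_vertex_ideal]) (auto intro!: lpa_of_in_lpa)
qed

text \<open>A missing letter is a vertex of \<open>H\<close> or belongs to an edge into
  \<open>H\<close>. In the latter case e = e r(e) and e* = r(e) e* put it into the kernel.\<close>

lemma to_quot_var_zero:
  assumes "g \<in> lpa_gens G" "g \<notin> lpa_gens Q"
  shows "to_quot (var g) = (azero (lpa_quot G H) :: ('v, 'e, 'k::field) lpa_elem set)"
proof -
  let ?J = "{p \<in> elts (free_alg (lpa_gens G)).
    to_quot p = (azero (lpa_quot G H) :: ('v, 'e, 'k) lpa_elem set)}"
  have V: "var (Vertex v) \<in> ?J" if "v \<in> H" for v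
    using that H_verts by (auto simp: to_quot_Vertex)
  have "var g \<in> ?J"
  proof (cases g)
    case (Vertex v)
    then have "v \<in> H"
      using assms by simp
    then show ?thesis
      unfolding Vertex by (rule V)
  next
    case (Edge e)
    then have "e \<in> arcs G" "head G e \<in> H"
      using assms by auto
    then show ?thesis
      unfolding Edge by (intro lpa_free_ideal.Edge_mem_if_head[OF lpa_free_ideal_kernel] V)
  next
    case (Ghost e)
    then have "e \<in> arcs G" "head G e \<in> H"
      using assms by auto
    then show ?thesis
      unfolding Ghost by (intro lpa_free_ideal.Ghost_mem_if_head[OF lpa_free_ideal_kernel] V)
  qed
  then show ?thesis
    by simp
qed

text \<open>All relations of the quotient graph but the last kind are relations of \<open>G\<close>.
  In the last kind the sum lacks the terms e e* of edges into \<open>H\<close>, which vanish in the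
  quotient algebra.\<close>

lemma to_quot_rel:
  assumes "r \<in> lpa_rels Q"
  shows "to_quot r = (azero (lpa_quot G H) :: ('v, 'e, 'k::field) lpa_elem set)"
proof -
  define J where "J = {p \<in> elts (free_alg (lpa_gens G)).
    to_quot p = (azero (lpa_quot G H) :: ('v, 'e, 'k) lpa_elem set)}"
  have Edge_J: "var (Edge e) \<in> J" if "e \<in> arcs G" "head G e \<in> H" for e
    using that by (simp add: J_def to_quot_var_zero)
  have "lpa_free_ideal G J"
    unfolding J_def by (rule lpa_free_ideal_kernel)
  then interpret J: lpa_free_ideal G J .
  have "r \<in> J"
    using assms
  proof (cases rule: lpa_rels_cases)
    case (CK2 v)
    have v: "v \<notin> H" "regular_vertex G v"
      using CK2(1) regular_quot_iff[of v] by (auto simp: regular_vertex_def)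
    have "(\<Sum>e\<in>out_arcs G v. var (Edge e) * var (Ghost e) :: ('v, 'e) lpa_gen list \<Rightarrow>\<^sub>0 'k) =
        (\<Sum>e\<in>out_arcs G v - out_arcs Q v. var (Edge e) * var (Ghost e)) +
        (\<Sum>e\<in>out_arcs Q v. var (Edge e) * var (Ghost e))"
      using finite_out_arcs by (intro sum.subset_diff) auto
    then have "r = (var (Vertex v) - (\<Sum>e\<in>out_arcs G v. var (Edge e) * var (Ghost e))) +
        (\<Sum>e\<in>out_arcs G v - out_arcs Q v. var (Edge e) * var (Ghost e))"
      using CK2(2) by simp
    moreover have "(\<Sum>e\<in>out_arcs G v - out_arcs Q v. var (Edge e) * var (Ghost e)) \<in> J"
      by (intro J.sum_mem J.mult_right_mem Edge_J) auto
    ultimately show ?thesis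
      using J.plus_mem J.rel_mem[OF lpa_rels_intros(7)[OF v(2)]] by simp
  qed (simp_all only: quot_simps Diff_iff J.rel_mem lpa_rels_intros)
  then show ?thesis
    unfolding J_def by blast
qed

text \<open>The property whose unique solution \<open>canonical_iso\<close> denotes.\<close>

definition is_canonical ::
  "(('v, 'e, 'k::field) lpa_elem set \<Rightarrow> ('v, 'e, 'k) lpa_elem) \<Rightarrow> bool" where
  "is_canonical \<phi> \<longleftrightarrow> \<phi> \<in> extensional (elts (lpa_quot G H)) \<and>
     alg_iso (lpa_quot G H) (lpa Q) \<phi> \<and>
     (\<forall>v\<in>verts G - H. \<phi> (lpa_class G H (lpa_of G (Vertex v))) = lpa_of Q (Vertex v)) \<and>
     (\<forall>e\<in>arcs G. head G e \<notin> H \<longrightarrow>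
        \<phi> (lpa_class G H (lpa_of G (Edge e))) = lpa_of Q (Edge e) \<and>
        \<phi> (lpa_class G H (lpa_of G (Ghost e))) = lpa_of Q (Ghost e))"

text \<open>The prescribed values cover only the letters of the quotient graph; at the other letters
  both sides are zero. As each element of the quotient algebra has the form
  \<open>to_quot p\<close>, this gives uniqueness.\<close>

lemma is_canonical_to_quot:
  assumes \<phi>: "is_canonical \<phi>" and p: "p \<in> elts (free_alg (lpa_gens G))"
  shows "\<phi> (to_quot p) = to_quot_graph p"
proof -
  have hom: "alg_hom (lpa_quot G H) (lpa Q) \<phi>"
    using \<phi> by (simp add: is_canonical_def alg_iso_def)
  interpret na_hom "lpa_quot G H" "lpa Q" \<phi>
    by (intro na_hom.intro na_hom_axioms.intro na_algebra_lpa_quot Q.na_algebra_lpa hom)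
  have "(\<phi> \<circ> to_quot) (var g) = to_quot_graph (var g)" if g: "g \<in> lpa_gens G" for g
  proof (cases "g \<in> lpa_gens Q")
    case True
    then have "\<phi> (lpa_class G H (lpa_of G g)) = lpa_of Q g"
      using \<phi> by (cases g) (simp_all add: is_canonical_def)
    then show ?thesis
      using True by (simp add: to_quot_def to_quot_graph_var lpa_of_eq)
  next
    case False
    then show ?thesis
      using g by (simp add: to_quot_var_zero to_quot_graph_var hom_zero)
  qed
  from free_alg_hom_eqI[OF Q.na_algebra_lpa alg_hom_comp[OF na_hom.hom[OF na_hom_to_quot] hom]
      na_hom.hom[OF na_hom_to_quot_graph] this p]
  show ?thesis
    by simp
qed

lemma ex_is_canonical:
  obtains \<phi> :: "('v, 'e, 'k::field) lpa_elem set \<Rightarrow> ('v, 'e, 'k) lpa_elem" where "is_canonical \<phi>"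
proof -
  obtain h :: "('v, 'e, 'k) lpa_elem \<Rightarrow> ('v, 'e, 'k) lpa_elem"
    where h: "alg_hom (lpa G) (lpa Q) h"
      "\<And>p. p \<in> elts (free_alg (lpa_gens G)) \<Longrightarrow> h (lpa_proj G p) = to_quot_graph p"
    by (rule lpa_factor[OF Q.na_algebra_lpa na_hom.hom[OF na_hom_to_quot_graph]
          to_quot_graph_rel]) (assumption | rule that)+
  interpret h: na_hom "lpa G" "lpa Q" h
    by (intro na_hom.intro na_hom_axioms.intro na_algebra_lpa Q.na_algebra_lpa h)
  have h_zero: "h x = azero (lpa Q)" if "x \<in> vertex_ideal G H" for x
  proof (rule h.hom_ideal_gen_eq_zero[OF _ _ that[unfolded vertex_ideal_def]])
    show "(\<lambda>v. lpa_of G (Vertex v)) ` H \<subseteq> elts (lpa G)"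
      using H_verts by (auto intro!: lpa_of_in_lpa)
    show "h y = azero (lpa Q)" if "y \<in> (\<lambda>v. lpa_of G (Vertex v)) ` H" for y
      using that H_verts by (auto simp: lpa_of_eq h(2) to_quot_graph_var)
  qed
  \<comment> \<open>The map \<open>h\<close> factors \<open>to_quot_graph\<close> through the
    relations of \<open>G\<close>; a second factorization, through I(H), gives the forward
    map.\<close>
  obtain \<phi> where \<phi>: "alg_hom (lpa_quot G H) (lpa Q) \<phi>"
    "\<And>x. x \<in> elts (lpa G) \<Longrightarrow> \<phi> (lpa_class G H x) = h x"
    by (rule h.alg_quot_factor[OF alg_ideal_vertex_ideal[OF H_verts] h_zero,
          folded lpa_quot_def lpa_class_def]) (assumption | rule that)+
  have \<phi>_to_quot: "\<phi> (to_quot p) = to_quot_graph p" if "p \<in> elts (free_alg (lpa_gens G))" for p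
    using that by (simp add: to_quot_def \<phi>(2) h(2) elts_lpa)
  \<comment> \<open>The inverse comes from the free algebra on the letters of the quotient graph,
    whose relations hold in L(G)/I(H).\<close>
  have "alg_hom (free_alg (lpa_gens Q)) (lpa_quot G H) to_quot"
    using lpa_gens_quot_subset na_hom.hom[OF na_hom_to_quot] by (rule alg_hom_free_alg_mono)
  then obtain \<psi> where \<psi>: "alg_hom (lpa Q) (lpa_quot G H) \<psi>"
    "\<And>p :: _ \<Rightarrow>\<^sub>0 'k. p \<in> elts (free_alg (lpa_gens Q)) \<Longrightarrow> \<psi> (lpa_proj Q p) = to_quot p"
    by (rule Q.lpa_factor[OF na_algebra_lpa_quot _ to_quot_rel]) (assumption | rule that)+
  have \<psi>\<phi>: "(\<psi> \<circ> to_quot_graph) p = to_quot p" if p: "p \<in> elts (free_alg (lpa_gens G))" for p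
  proof (rule free_alg_hom_eqI[OF na_algebra_lpa_quot
        alg_hom_comp[OF na_hom.hom[OF na_hom_to_quot_graph] \<psi>(1)] na_hom.hom[OF na_hom_to_quot] _ p])
    fix g assume g: "g \<in> lpa_gens G"
    interpret \<psi>: na_hom "lpa Q" "lpa_quot G H" \<psi>
      by (intro na_hom.intro na_hom_axioms.intro na_algebra_lpa_quot Q.na_algebra_lpa \<psi>)
    show "(\<psi> \<circ> to_quot_graph) (var g) = to_quot (var g)"
      using g by (simp add: to_quot_graph_var lpa_of_eq \<psi>(2) \<psi>.hom_zero to_quot_var_zero)
  qed
  have "bij_betw \<phi> (elts (lpa_quot G H)) (elts (lpa Q))"
  proof (rule bij_betwI)
    show "\<phi> \<in> elts (lpa_quot G H) \<rightarrow> elts (lpa Q)" "\<psi> \<in> elts (lpa Q) \<rightarrow> elts (lpa_quot G H)"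
      using \<phi>(1) \<psi>(1) by (auto simp: alg_hom_def)
    show "\<psi> (\<phi> x) = x" if "x \<in> elts (lpa_quot G H)" for x
      using that \<phi>_to_quot \<psi>\<phi> by (auto simp: elts_lpa_quot)
    show "\<phi> (\<psi> y) = y" if "y \<in> elts (lpa Q)" for y
    proof -
      obtain p where p: "p \<in> elts (free_alg (lpa_gens Q))" "y = lpa_proj Q p"
        using \<open>y \<in> _\<close> by (auto simp: Q.elts_lpa)
      then show ?thesis
        by (simp add: \<psi>(2) \<phi>_to_quot subsetD[OF free_alg_quot_subset] to_quot_graph_def
            restrict_gens_quot)
    qed
  qed
  define \<phi>' where "\<phi>' = restrict \<phi> (elts (lpa_quot G H))"
  have eq: "\<phi>' x = \<phi> x" if "x \<in> elts (lpa_quot G H)" for x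
    using that by (simp add: \<phi>'_def)
  have gen: "\<phi>' (lpa_class G H (lpa_of G g)) = lpa_of Q g"
    if "g \<in> lpa_gens Q" for g
  proof -
    have "g \<in> lpa_gens G"
      using that lpa_gens_quot_subset by blast
    then have "\<phi>' (to_quot (var g)) = to_quot_graph (var g)"
      by (simp add: eq elts_lpa_quot \<phi>_to_quot)
    then show ?thesis
      using that by (simp add: to_quot_def to_quot_graph_var lpa_of_eq)
  qed
  have "alg_iso (lpa_quot G H) (lpa Q) \<phi>'"
    using \<phi>(1) \<open>bij_betw \<phi> _ _\<close> alg_hom_cong[OF na_algebra_lpa_quot eq, where B = "lpa Q"]
      bij_betw_cong[of "elts (lpa_quot G H)" \<phi>' \<phi> "elts (lpa Q)"] eq
    by (simp add: alg_iso_def)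
  then have "is_canonical \<phi>'"
    unfolding is_canonical_def by (auto simp: gen) (simp add: \<phi>'_def)
  then show thesis
    by (rule that)
qed

lemma is_canonical_canonical_iso:
  "is_canonical (canonical_iso G H :: ('v, 'e, 'k::field) lpa_elem set \<Rightarrow> _)"
proof -
  obtain \<phi> :: "('v, 'e, 'k) lpa_elem set \<Rightarrow> ('v, 'e, 'k) lpa_elem" where \<phi>: "is_canonical \<phi>"
    by (rule ex_is_canonical)
  have "\<phi>' = \<phi>" if "is_canonical \<phi>'" for \<phi>'
  proof (rule extensionalityI[of _ "elts (lpa_quot G H)"])
    show "\<phi>' \<in> extensional (elts (lpa_quot G H))" "\<phi> \<in> extensional (elts (lpa_quot G H))"
      using that \<phi> by (simp_all add: is_canonical_def)
    show "\<phi>' x = \<phi> x" if "x \<in> elts (lpa_quot G H)" for x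
      using that is_canonical_to_quot[OF \<phi>] is_canonical_to_quot[OF \<open>is_canonical \<phi>'\<close>]
      by (auto simp: elts_lpa_quot)
  qed
  with \<phi> have "is_canonical (THE \<phi> :: ('v, 'e, 'k) lpa_elem set \<Rightarrow> _. is_canonical \<phi>)"
    by (rule theI)
  then show ?thesis
    by (simp add: canonical_iso_def is_canonical_def)
qed

text \<open>Composed with the projections from the free algebra, the canonical map is the surjection
  \<open>to_quot_graph\<close>, so generated ideals go to generated ideals.\<close>

lemma canonical_iso_image_vertex_ideal:
  assumes "Y \<subseteq> verts G"
  shows "canonical_iso G H ` lpa_class G H ` vertex_ideal G Y =
    (vertex_ideal Q (Y - H) :: ('v, 'e, 'k::field) lpa_elem set)"
proof -
  let ?V = "(\<lambda>v. var (Vertex v) :: _ \<Rightarrow>\<^sub>0 'k) ` Y"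
  interpret F: na_hom "free_alg (lpa_gens G)" "lpa Q"
      "to_quot_graph :: _ \<Rightarrow> ('v, 'e, 'k) lpa_elem"
    by (rule na_hom_to_quot_graph)
  have V: "?V \<subseteq> elts (free_alg (lpa_gens G))"
    using assms by auto
  have "ideal_gen (free_alg (lpa_gens G)) ?V \<subseteq> elts (free_alg (lpa_gens G))"
    using F.A.alg_ideal_ideal_gen[OF V] by (simp add: alg_ideal_def)
  then have "canonical_iso G H ` lpa_class G H ` vertex_ideal G Y =
      to_quot_graph ` ideal_gen (free_alg (lpa_gens G)) ?V"
    using is_canonical_to_quot[OF is_canonical_canonical_iso, unfolded to_quot_def]
    unfolding vertex_ideal_eq[OF assms] image_image by (intro image_cong) auto
  also have "\<dots> = ideal_gen (lpa Q) (to_quot_graph ` ?V)"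
    by (rule F.image_ideal_gen[OF to_quot_graph_surj V])
  \<comment> \<open>Adjoining zero absorbs the generators from \<open>H\<close>, all of which are
    zero, whether or not there are any.\<close>
  also have "\<dots> = ideal_gen (lpa Q) (insert (azero (lpa Q)) (to_quot_graph ` ?V))"
    by (rule ideal_gen_insert_zero[symmetric])
  also have "to_quot_graph ` ?V =
      (\<lambda>v. if v \<in> H then azero (lpa Q) else lpa_of Q (Vertex v)) ` Y"
    unfolding image_image
    by (intro image_cong) (simp_all add: to_quot_graph_var subsetD[OF assms])
  also have "insert (azero (lpa Q)) \<dots> =
      insert (azero (lpa Q)) ((\<lambda>v. lpa_of Q (Vertex v)) ` (Y - H))"
    by (rule insert_image_if)
  also have "ideal_gen (lpa Q) \<dots> = vertex_ideal Q (Y - H)"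
    unfolding vertex_ideal_def by (rule ideal_gen_insert_zero)
  finally show ?thesis .
qed

section \<open>The next set as the solution of an equation of ideals\<close>

lemma row_finite_quot: "row_finite Q"
  unfolding row_finite_def using finite_out_arcs_quot by blast

text \<open>The recovery of a set from its vertex ideal, applied to the quotient graph, in which
  \<open>Y - H\<close> is hereditary and saturated.\<close>

lemma vertex_in_vertex_ideal_quot_iff:
  assumes "her_sat G Y" "H \<subseteq> Y" "v \<in> verts G - H"
  shows "(lpa_of Q (Vertex v) :: ('v, 'e, 'k::field) lpa_elem) \<in> vertex_ideal Q (Y - H) \<longleftrightarrow>
    v \<in> Y"
proof -
  have "her_sat_graph Q (Y - H)"
    by (intro her_sat_graph.intro her_sat_graph_axioms.intro Q.wf_digraph_axioms row_finite_quot
        her_sat_quot assms)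
  from her_sat_graph.vertex_in_vertex_ideal_iff[OF this, of v] show ?thesis
    using assms by simp
qed

lemma Pc_next_eqI:
  assumes Y: "her_sat G Y" "H \<subseteq> Y"
    and eq: "(vertex_ideal Q (Y - H) :: ('v, 'e, 'k::field) lpa_elem set) = vertex_ideal Q (Pc Q)"
  shows "Pc_next TYPE('k) G H = Y"
  unfolding Pc_next_def
proof (rule the_equality)
  show "her_sat G Y \<and> H \<subseteq> Y \<and> canonical_iso G H ` lpa_class G H ` vertex_ideal G Y =
      (vertex_ideal Q (Pc Q) :: ('v, 'e, 'k) lpa_elem set)"
    using assms by (simp add: canonical_iso_image_vertex_ideal her_sat_def)
next
  fix X
  assume X: "her_sat G X \<and> H \<subseteq> X \<and> canonical_iso G H ` lpa_class G H ` vertex_ideal G X =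
      (vertex_ideal Q (Pc Q) :: ('v, 'e, 'k) lpa_elem set)"
  then have "X \<subseteq> verts G"
    by (simp add: her_sat_def)
  from canonical_iso_image_vertex_ideal[OF this, where 'k = 'k] X
  have "vertex_ideal Q (X - H) = (vertex_ideal Q (Y - H) :: ('v, 'e, 'k) lpa_elem set)"
    unfolding eq by simp
  \<comment> \<open>Equal ideals contain the same vertices, so \<open>X\<close> and \<open>Y\<close>
    agree outside \<open>H\<close>; both contain \<open>H\<close>.\<close>
  then have "v \<in> X \<longleftrightarrow> v \<in> Y" if "v \<in> verts G - H" for v
    using that X Y vertex_in_vertex_ideal_quot_iff[where 'k = 'k] by metis
  moreover have "X \<subseteq> verts G" "H \<subseteq> X" "Y \<subseteq> verts G" "H \<subseteq> Y"
    using X Y by (auto simp: her_sat_def)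
  ultimately show "X = Y"
    by blast
qed


end

section \<open>Cycles whose exits lead into a hereditary and saturated set\<close>

text \<open>The set S_n of the theorem as a function of P_c^(n); its monotonicity drives the
  induction.\<close>

definition exit_into_verts :: "('v, 'e) pre_digraph \<Rightarrow> 'v set \<Rightarrow> 'v set" where
  "exit_into_verts E P = {v \<in> verts E. \<exists>c. pre_digraph.cycle E c \<and> v \<in> cycle_verts E c \<and>
     (\<forall>f. is_exit E c f \<longrightarrow> head E f \<in> P)}"

lemma exit_into_verts_mono: "P \<subseteq> P' \<Longrightarrow> exit_into_verts E P \<subseteq> exit_into_verts E P'"
  unfolding exit_into_verts_def by blast

lemma her_sat_closure_mono: "X \<subseteq> Y \<Longrightarrow> her_sat_closure E X \<subseteq> her_sat_closure E Y"
  unfolding her_sat_closure_def by blast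

lemma (in wf_digraph) cycle_verts_verts: "cycle c \<Longrightarrow> cycle_verts G c \<subseteq> verts G"
  by (auto simp: cycle_def awalk_def cycle_verts_def)

context her_sat_graph
begin

text \<open>The vertex list and the connectedness of a walk depend on \<open>tail\<close> and
  \<open>head\<close> alone, which the two graphs share.\<close>

lemma awalk_verts_quot: "pre_digraph.awalk_verts Q u p = awalk_verts u p"
  by (simp add: pre_digraph.awalk_verts_conv)

lemma cas_quot: "pre_digraph.cas Q u p v \<longleftrightarrow> cas u p v"
  by (induction p arbitrary: u) (simp_all add: pre_digraph.cas.simps)

lemma set_subset_arcs_quot [simp]:
  "set c \<subseteq> arcs Q \<longleftrightarrow> set c \<subseteq> arcs G \<and> (\<forall>e\<in>set c. head G e \<notin> H)"
  by (auto simp: subset_iff)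

lemma cycle_quotD:
  assumes "pre_digraph.cycle Q c"
  shows "cycle c"
  using assms
  by (auto simp: pre_digraph.cycle_def pre_digraph.awalk_def awalk_verts_quot cas_quot)

text \<open>From the head of \<open>e\<close> the cycle runs on to its base point \<open>u\<close>,
  and from there to each of its vertices.\<close>

lemma cycle_verts_in_H:
  assumes "cycle c" "e \<in> set c" "head G e \<in> H"
  shows "cycle_verts G c \<subseteq> H"
proof
  fix v assume "v \<in> cycle_verts G c"
  then obtain e' where e': "e' \<in> set c" "v = tail G e'"
    by (auto simp: cycle_verts_def)
  obtain u where u: "awalk u c u"
    using assms(1) by (auto simp: cycle_def)
  obtain p q where "c = p @ e # q"
    using assms(2) by (auto dest: split_list)
  then have "awalk (head G e) q u"
    using u by (simp add: awalk_Cons_iff)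
  moreover obtain p' q' where "c = p' @ e' # q'"
    using e' by (auto dest: split_list)
  then have "awalk u p' v"
    using u e' by (auto simp: awalk_Cons_iff)
  ultimately have "head G e \<rightarrow>\<^sup>*\<^bsub>G\<^esub> v"
    by (metis reachable_awalk reachable_trans)
  then show "v \<in> H"
    using assms(3) H_hereditary by (simp add: hereditary_def)
qed

lemma cycle_quotI:
  assumes c: "cycle c" and avoids: "\<And>e. e \<in> set c \<Longrightarrow> head G e \<notin> H"
  shows "pre_digraph.cycle Q c"
proof -
  obtain u where u: "awalk u c u" "distinct (tl (awalk_verts u c))" "c \<noteq> []"
    using c by (auto simp: cycle_def)
  have arcs: "set c \<subseteq> arcs G"
    using u(1) by (simp add: awalk_def)
  \<comment> \<open>The base point must be a vertex of the quotient graph; if it were in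
    \<open>H\<close>, so would be the head of the first edge.\<close>
  have "tail G (hd c) = u" "hd c \<in> set c"
    using u(1,3) by (cases c; simp add: awalk_Cons_iff)+
  then have "u \<notin> H"
    using avoids[of "hd c"] head_in_H[of "hd c"] arcs by auto
  then show ?thesis
    using u arcs avoids
    by (auto simp: pre_digraph.cycle_def pre_digraph.awalk_def awalk_verts_quot cas_quot)
qed

lemma is_exit_quot: "is_exit Q c f \<longleftrightarrow> is_exit G c f \<and> head G f \<notin> H"
  by (auto simp: is_exit_def)

lemma Pc_quot_subset: "Pc Q \<subseteq> exit_into_verts G H"
proof
  fix v assume "v \<in> Pc Q"
  then obtain c where c: "pre_digraph.cycle Q c" "v \<in> cycle_verts Q c" "\<nexists>f. is_exit Q c f"
    by (auto simp: Pc_def)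
  then have "v \<in> cycle_verts G c" "\<forall>f. is_exit G c f \<longrightarrow> head G f \<in> H" "cycle c"
    by (auto simp: is_exit_quot cycle_verts_def cycle_quotD)
  then show "v \<in> exit_into_verts G H"
    using cycle_verts_verts[of c] by (auto simp: exit_into_verts_def)
qed

text \<open>A cycle with an edge into \<open>H\<close> lies in \<open>H\<close> entirely. Any other
  is a cycle of the quotient graph, where its exits have been deleted.\<close>

lemma exit_into_verts_subset: "exit_into_verts G H \<subseteq> H \<union> Pc Q"
proof
  fix v assume "v \<in> exit_into_verts G H"
  then obtain c where c: "cycle c" "v \<in> cycle_verts G c"
    "\<And>f. is_exit G c f \<Longrightarrow> head G f \<in> H"
    by (auto simp: exit_into_verts_def)
  show "v \<in> H \<union> Pc Q"
  proof (cases "\<exists>e\<in>set c. head G e \<in> H")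
    case True
    then show ?thesis
      using c cycle_verts_in_H by blast
  next
    case False
    then have "pre_digraph.cycle Q c"
      using c(1) by (intro cycle_quotI) auto
    moreover have "v \<in> cycle_verts Q c" "\<nexists>f. is_exit Q c f"
      using c by (auto simp: is_exit_quot cycle_verts_def)
    ultimately show ?thesis
      by (auto simp: Pc_def)
  qed
qed

lemma Pc_next_eq_closure:
  assumes "H \<subseteq> her_sat_closure G (exit_into_verts G H)"
  shows "Pc_next TYPE('k::field) G H = her_sat_closure G (exit_into_verts G H)"
proof (rule Pc_next_eqI)
  let ?Y = "her_sat_closure G (exit_into_verts G H)"
  let ?I = "vertex_ideal Q (Pc Q) :: ('v, 'e, 'k) lpa_elem set"
  have sub: "exit_into_verts G H \<subseteq> verts G"
    by (auto simp: exit_into_verts_def)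
  show Y: "her_sat G ?Y"
    using sub by (rule her_sat_her_sat_closure)
  show "H \<subseteq> ?Y"
    by fact
  have Pc_verts: "Pc Q \<subseteq> verts Q"
    using Q.cycle_verts_verts by (auto simp: Pc_def)
  then have ideal: "alg_ideal (lpa Q) ?I"
    by (rule Q.alg_ideal_vertex_ideal)
  have Pc_I: "lpa_of Q (Vertex v) \<in> ?I" if "v \<in> Pc Q" for v
    using that subset_ideal_gen[of "(\<lambda>v. lpa_of Q (Vertex v)) ` Pc Q" "lpa Q"]
    by (auto simp: vertex_ideal_def)
  \<comment> \<open>The closure is not computed but bounded by the vertices that the ideal already
    contains, so the generators from \<open>?Y - H\<close> add nothing to it.\<close>
  let ?Z = "{v \<in> verts Q. lpa_of Q (Vertex v) \<in> ?I}"
  have "her_sat G (H \<union> ?Z)"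
    by (intro her_sat_union Q.her_sat_vertices_of_ideal ideal)
  moreover have "exit_into_verts G H \<subseteq> H \<union> ?Z"
    using exit_into_verts_subset Pc_I Pc_verts by blast
  ultimately have "?Y \<subseteq> H \<union> ?Z"
    by (rule her_sat_closure_least)
  then have "(\<lambda>v. lpa_of Q (Vertex v)) ` (?Y - H) \<subseteq> ?I"
    by auto
  then have "vertex_ideal Q (?Y - H) \<subseteq> ?I"
    unfolding vertex_ideal_def[of Q "?Y - H"] by (rule ideal_gen_least[OF ideal])
  moreover have "Pc Q \<subseteq> ?Y - H"
    using Pc_quot_subset subset_her_sat_closure Pc_verts by fastforce
  then have "?I \<subseteq> vertex_ideal Q (?Y - H)"
    unfolding vertex_ideal_def by (intro ideal_gen_mono image_mono)
  ultimately show "vertex_ideal Q (?Y - H) = ?I"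
    by (rule equalityI)
qed

end

section \<open>Induction on n\<close>

lemma (in wf_digraph) Pc_subset: "Pc G \<subseteq> exit_into_verts G P"
  unfolding Pc_def exit_into_verts_def
  by (auto simp: cycle_def awalk_def cycle_verts_def)

text \<open>The three parts support each other: the first two are what
  \<open>Pc_next_eq_closure\<close> requires, and the equation for \<open>Suc n\<close> yields these
  two at the next index.\<close>

lemma Pc_seq_her_sat:
  assumes "wf_digraph E" "row_finite E" "n \<ge> 1"
  shows "her_sat E (Pc_seq TYPE('k::field) E n) \<and>
    Pc_seq TYPE('k) E n \<subseteq> her_sat_closure E (exit_into_verts E (Pc_seq TYPE('k) E n)) \<and>
    Pc_seq TYPE('k) E (Suc n) = her_sat_closure E (exit_into_verts E (Pc_seq TYPE('k) E n))"
  (is "?P n")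
proof -
  interpret wf_digraph E
    by fact
  let ?p = "Pc_seq TYPE('k) E"
  let ?S = "exit_into_verts E"
  have verts: "?S P \<subseteq> verts E" for P
    by (auto simp: exit_into_verts_def)
  have step: "?P n"
    if "n \<ge> 1" "her_sat E (?p n)" "?p n \<subseteq> her_sat_closure E (?S (?p n))" for n
  proof -
    have "her_sat_graph E (?p n)"
      using that assms(2)
      by (intro her_sat_graph.intro her_sat_graph_axioms.intro wf_digraph_axioms)
    then have "Pc_next TYPE('k) E (?p n) = her_sat_closure E (?S (?p n))"
      using that(3) by (rule her_sat_graph.Pc_next_eq_closure)
    \<comment> \<open>Here \<open>n\<close> is a successor, so the dummy value at 0 is not
      reached.\<close>
    moreover have "?p (Suc n) = Pc_next TYPE('k) E (?p n)"
      using \<open>n \<ge> 1\<close> by (cases n) simp_all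
    ultimately show ?thesis
      using that by metis
  qed
  show ?thesis
    using assms(3)
  proof (induction n rule: nat_induct_at_least)
    \<comment> \<open>A cycle without exits satisfies the condition on exits vacuously, so the
      closure of \<open>Pc E\<close> is contained in that of S_1.\<close>
    case base
    have "Pc E \<subseteq> verts E"
      using Pc_subset verts by blast
    then show ?case
      using her_sat_closure_mono[OF Pc_subset]
      by (intro step) (simp_all add: her_sat_her_sat_closure)
  next
    case (Suc n)
    then have eq: "?p (Suc n) = her_sat_closure E (?S (?p n))"
      by blast
    have "?p n \<subseteq> ?p (Suc n)"
      unfolding eq using Suc.IH by blast
    then have "?S (?p n) \<subseteq> ?S (?p (Suc n))"
      by (rule exit_into_verts_mono)
    then have "?p (Suc n) \<subseteq> her_sat_closure E (?S (?p (Suc n)))"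
      using eq her_sat_closure_mono by metis
    moreover have "her_sat E (?p (Suc n))"
      unfolding eq by (rule her_sat_her_sat_closure[OF verts])
    ultimately show ?case
      by (intro step) simp_all
  qed
qed

theorem theorem5p3:
  fixes E :: "('v, 'e) pre_digraph" and n :: nat
  assumes "wf_digraph E"
    and "row_finite E"
    and "n \<ge> 1"
  shows "Pc_seq TYPE('k::field) E (n + 1) =
    her_sat_closure E
      {v \<in> verts E. \<exists>c. pre_digraph.cycle E c \<and> v \<in> cycle_verts E c \<and>
         (\<forall>f. is_exit E c f \<longrightarrow> head E f \<in> Pc_seq TYPE('k) E n)}"
  using Pc_seq_her_sat[OF assms, where 'k = 'k] by (simp add: exit_into_verts_def del: Pc_seq.simps)

end
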